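(* Let $d\ge 1$ and $k=d$. Suppose data are generated as follows: $Z\in\mathbb{R}^d$ is a random vector whose components are mutually independent, non-Gaussian, and have finite second moments; $X=g(Z)$ for a bijection $g:\mathbb{R}^d\to\mathbb{R}^d$; and either (regression) $Y=\Gamma Z+N_Y$ with $\Gamma\in\mathbb{R}^{k\times d}$ and $N_Y\in\mathbb{R}^k$ independent of $Z$ with $\mathbb{E}[N_Y]=0$, or (classification) $Y\sim\mathsf{Bernoulli}(\sigma(\Gamma Z))$ elementwise with $\sigma$ the elementwise sigmoid. Consider predictors $\Theta\circ\Phi$ with $\Phi\in\mathcal{H}_\Phi$ (a class of maps $\mathbb{R}^d\to\mathbb{R}^d$ containing $g^{-1}$) and $\Theta\in\mathcal{H}_\Theta$, the set of all invertible $d\times d$ matrices, with $\Gamma\in\mathcal{H}_\Theta$. Let $R(\Theta\circ\Phi)=\mathbb{E}[\ell(Y,\Theta\Phi(X))]$ with $\ell$ the square loss (regression) or the cross-entropy loss with logits $\Theta\Phi(X)$ (classification). ERM-ICA procedure: (1) ERM phase: take $(\Theta^\dagger,\Phi^\dagger)\in\arg\min_{\Theta\in\mathcal{H}_\Theta,\Phi\in\mathcal{H}_\Phi}R(\Theta\circ\Phi)$. (2) ICA phase: assuming $\Phi^\dagger(X)$ has zero mean, finite second moments and invertible covariance $V=U_0\Lambda_0^2U_0^{\mathsf T}$ (eigendecomposition), form the whitened representation $\Phi^*(X)=\Lambda_0^{-1}U_0^{\mathsf T}\Phi^\dagger(X)$ and take $\Omega^\dagger\in\arg\min_{\Omega\text{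 invertible}} I(\Omega\Phi^*(X))$, where $I(W)$ denotes the mutual information (total correlation) of the random vector $W$, i.e., the Kullback–Leibler divergence between the law of $W$ and the product of its marginals. Then the representation output by ERM-ICA, $\Omega^\dagger\Phi^*(X)$, identifies $Z$ up to permutation and scaling: there exist a permutation matrix $P$ and an invertible diagonal matrix $\Lambda$ such that $\Omega^\dagger\Phi^*(X)=P\Lambda Z$ almost surely.
   Context: $\mathsf{Bernoulli}(q)$ denotes the Bernoulli distribution on $\{0,1\}$ with success probability $q$. Components of a random vector are mutually independent if the joint law of every subfamily equals the product of its marginals.
   Formalization: In the regression case the noise N_Y is additionally assumed to have finite second moments (otherwise every risk is infinite, every pair is a minimizer and the claim fails); g and all maps in H_Φ are assumed Borel measurable. *)

theory Defs
  imports "HOL-Probability.Probability"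
begin

definition sigmoid :: "real \<Rightarrow> real" where
  "sigmoid t = 1 / (1 + exp (- t))"

text \<open>Square loss (regression) and cross-entropy loss with logits s (classification).
  Both are nonnegative, so the risk is taken as a nonnegative (possibly infinite) integral.\<close>
definition square_loss :: "real^'d \<Rightarrow> real^'d \<Rightarrow> ennreal" where
  "square_loss y s = ennreal ((norm (y - s))\<^sup>2)"

definition cross_entropy_loss :: "real^'d \<Rightarrow> real^'d \<Rightarrow> ennreal" where
  "cross_entropy_loss y s = ennreal (\<Sum>i\<in>UNIV.
      - (y$i * ln (sigmoid (s$i)) + (1 - y$i) * ln (1 - sigmoid (s$i))))"

definition risk :: "'a measure \<Rightarrow> (real^'d \<Rightarrow> real^'d \<Rightarrow> ennreal) \<Rightarrow> ('a \<Rightarrow> real^'d)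
    \<Rightarrow> ('a \<Rightarrow> real^'d) \<Rightarrow> real^'d^'d \<Rightarrow> (real^'d \<Rightarrow> real^'d) \<Rightarrow> ennreal" where
  "risk M loss Y X \<Theta> \<Phi> = (\<integral>\<^sup>+ \<omega>. loss (Y \<omega>) (\<Theta> *v \<Phi> (X \<omega>)) \<partial>M)"

definition KL_div :: "'b measure \<Rightarrow> 'b measure \<Rightarrow> ennreal" where
  "KL_div P Q =
     (if sets P = sets Q \<and> absolutely_continuous Q P
         \<and> integrable P (\<lambda>x. ln (enn2real (RN_deriv Q P x)))
      then ennreal (\<integral>x. ln (enn2real (RN_deriv Q P x)) \<partial>P)
      else \<infinity>)"

definition marginal_product :: "'a measure \<Rightarrow> ('a \<Rightarrow> real^'d) \<Rightarrow> (real^'d) measure" where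
  "marginal_product M W =
     distr (PiM UNIV (\<lambda>i. distr M borel (\<lambda>\<omega>. W \<omega> $ i))) borel (\<lambda>f. \<chi> i. f i)"

definition total_correlation :: "'a measure \<Rightarrow> ('a \<Rightarrow> real^'d) \<Rightarrow> ennreal" where
  "total_correlation M W = KL_div (distr M borel W) (marginal_product M W)"

definition gaussian_rv :: "'a measure \<Rightarrow> ('a \<Rightarrow> real) \<Rightarrow> bool" where
  "gaussian_rv M V \<longleftrightarrow>
     (\<exists>\<mu> \<sigma>. \<sigma> > 0 \<and> distributed M lborel V (\<lambda>x. ennreal (normal_density \<mu> \<sigma> x)))"

definition permutation_matrix :: "real^'n^'n \<Rightarrow> bool" where
  "permutation_matrix P \<longleftrightarrow>
     (\<exists>p. p permutes (UNIV :: 'n set) \<and> P = (\<chi> i j. if j = p i then 1 else 0))"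

definition diagonal_matrix :: "real^'n^'n \<Rightarrow> bool" where
  "diagonal_matrix A \<longleftrightarrow> (\<forall>i j. i \<noteq> j \<longrightarrow> A $ i $ j = 0)"

text \<open>Regression data: Y = Gamma Z + N_Y, N_Y independent of Z, E[N_Y] = 0
  (with finite second moments, so that the square-loss risk is finite).\<close>
definition regression_data :: "'a measure \<Rightarrow> ('a \<Rightarrow> real^'d) \<Rightarrow> ('a \<Rightarrow> real^'d)
    \<Rightarrow> real^'d^'d \<Rightarrow> bool" where
  "regression_data M Z Y \<Gamma> \<longleftrightarrow>
     (\<exists>N. N \<in> borel_measurable M
        \<and> prob_space.indep_var M borel Z borel N
        \<and> (\<forall>i. integrable M (\<lambda>\<omega>. N \<omega> $ i) \<and> (\<integral>\<omega>. N \<omega> $ i \<partial>M) = 0)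
        \<and> (\<forall>i. integrable M (\<lambda>\<omega>. (N \<omega> $ i)\<^sup>2))
        \<and> (\<forall>\<omega>\<in>space M. Y \<omega> = \<Gamma> *v Z \<omega> + N \<omega>))"

text \<open>Classification data: Y takes values in {0,1}^d and, for each coordinate i,
  P(Y_i = 1 | Z) = sigmoid((Gamma Z)_i), stated via the defining property of
  conditional probability.\<close>
definition classification_data :: "'a measure \<Rightarrow> ('a \<Rightarrow> real^'d) \<Rightarrow> ('a \<Rightarrow> real^'d)
    \<Rightarrow> real^'d^'d \<Rightarrow> bool" where
  "classification_data M Z Y \<Gamma> \<longleftrightarrow>
     Y \<in> borel_measurable M
     \<and> (\<forall>\<omega>\<in>space M. \<forall>i. Y \<omega> $ i \<in> {0, 1})
     \<and> (\<forall>i. \<forall>B\<in>sets borel.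
          measure M {\<omega>\<in>space M. Z \<omega> \<in> B \<and> Y \<omega> $ i = 1}
          = (\<integral>\<omega>. indicator {\<omega>\<in>space M. Z \<omega> \<in> B} \<omega> * sigmoid ((\<Gamma> *v Z \<omega>) $ i) \<partial>M))"

end

(*
  Both losses are strictly proper: any risk minimiser has logits \<Gamma> Z almost surely, because the
  excess risk is E |\<Gamma> Z - \<Theta> \<Phi>(X)|^2 for the square loss and the expected gap between the strictly
  convex function ln (1 + e^s) and its tangent for the cross entropy. Hence the learned representation
  is an invertible linear image of Z, and the ICA output is B Z with B invertible. Unmixing attains
  total correlation 0, so the components of B Z are independent.

  Let \<phi>_l be the characteristic function of Z_l. Independence of the components of Z and of B Z says
  that u \<mapsto> \<Prod>l. \<phi>_l ((B^T u)_l) is a product of functions of the single u_i, so the mixed log-derivative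
  in u_i and u_k vanishes: \<Sum>l. B_il B_kl (log \<phi>_l)'' (x_l) = 0 at every x where no factor vanishes, since
  x = B^T u is arbitrary. Moving x_j alone shows that (log \<phi>_j)'' is constant when B_ij B_kj \<noteq> 0, so
  Z_j is Gaussian. As no Z_j is, each column of B has a single nonzero entry.
*)
theory Submission
  imports Defs
begin

section \<open>Derivatives of characteristic functions\<close>

text \<open>Difference quotients can be followed along sequences, which is the form that dominated
  convergence handles.\<close>

lemma has_vector_derivative_at_iff_quotient:
  fixes f :: "real \<Rightarrow> 'b::real_normed_vector"
  shows "(f has_vector_derivative D) (at x) \<longleftrightarrow>
    ((\<lambda>y. (f y - f x) /\<^sub>R (y - x)) \<longlongrightarrow> D) (at x)"
proof -
  have eq: "norm ((f y - f x) - (y - x) *\<^sub>R D) / norm (y - x) = norm ((f y - f x) /\<^sub>R (y - x) - D)"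
    if "y \<noteq> x" for y
  proof -
    have "(f y - f x) /\<^sub>R (y - x) - D = ((f y - f x) - (y - x) *\<^sub>R D) /\<^sub>R (y - x)"
      using that by (simp add: scaleR_diff_right)
    then show ?thesis by (simp add: divide_inverse mult.commute)
  qed
  have "(f has_vector_derivative D) (at x) \<longleftrightarrow>
      ((\<lambda>y. norm ((f y - f x) - (y - x) *\<^sub>R D) / norm (y - x)) \<longlongrightarrow> 0) (at x)"
    by (simp add: has_vector_derivative_def has_derivative_iff_norm bounded_linear_scaleR_left)
  also have "\<dots> \<longleftrightarrow> ((\<lambda>y. norm ((f y - f x) /\<^sub>R (y - x) - D)) \<longlongrightarrow> 0) (at x)"
    by (intro filterlim_cong refl) (auto simp: eventually_at_filter eq[unfolded real_norm_def])
  also have "\<dots> \<longleftrightarrow> ((\<lambda>y. (f y - f x) /\<^sub>R (y - x)) \<longlongrightarrow> D) (at x)"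
    by (simp add: tendsto_norm_zero_iff LIM_zero_iff)
  finally show ?thesis .
qed

text \<open>Differentiation under the integral sign: the mean value inequality turns the bound
  \<open>G\<close> on the derivatives into a bound on all difference quotients, and dominated
  convergence does the rest.\<close>

lemma has_vector_derivative_integral_dominated:
  fixes F :: "real \<Rightarrow> 'a \<Rightarrow> 'b::{banach, second_countable_topology}"
  assumes int: "\<And>x. integrable M (F x)"
    and meas: "\<And>x. F' x \<in> borel_measurable M"
    and deriv: "\<And>x \<omega>. ((\<lambda>x. F x \<omega>) has_vector_derivative F' x \<omega>) (at x)"
    and bound: "\<And>x \<omega>. norm (F' x \<omega>) \<le> G \<omega>"
    and G: "integrable M G"
  shows "((\<lambda>x. \<integral>\<omega>. F x \<omega> \<partial>M) has_vector_derivative (\<integral>\<omega>. F' x \<omega> \<partial>M)) (at x)"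
proof -
  have lip: "norm (F y \<omega> - F x \<omega>) \<le> G \<omega> * norm (y - x)" for y \<omega>
  proof (rule differentiable_bound[of UNIV "\<lambda>x. F x \<omega>" "\<lambda>x h. h *\<^sub>R F' x \<omega>"])
    show "onorm (\<lambda>h. h *\<^sub>R F' x \<omega>) \<le> G \<omega>" for x
      using bound[of x \<omega>] by (intro onorm_le) (simp add: mult_left_mono mult.commute[of "G \<omega>"])
  qed (use deriv in \<open>auto simp: has_vector_derivative_def\<close>)
  show ?thesis
    unfolding has_vector_derivative_at_iff_quotient tendsto_at_iff_sequentially
  proof safe
    fix X :: "nat \<Rightarrow> real" assume X: "\<forall>i. X i \<in> UNIV - {x}" "X \<longlonglongrightarrow> x"
    have "(\<lambda>n. \<integral>\<omega>. (F (X n) \<omega> - F x \<omega>) /\<^sub>R (X n - x) \<partial>M) \<longlonglongrightarrow> (\<integral>\<omega>. F' x \<omega> \<partial>M)"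
    proof (rule integral_dominated_convergence[OF _ _ G])
      show "AE \<omega> in M. (\<lambda>n. (F (X n) \<omega> - F x \<omega>) /\<^sub>R (X n - x)) \<longlonglongrightarrow> F' x \<omega>"
        using deriv[of _ x, unfolded has_vector_derivative_at_iff_quotient tendsto_at_iff_sequentially,
            rule_format, of X] X
        by (intro AE_I2) (auto simp: comp_def)
      show "AE \<omega> in M. norm ((F (X n) \<omega> - F x \<omega>) /\<^sub>R (X n - x)) \<le> G \<omega>" for n
      proof (rule AE_I2)
        fix \<omega>
        have "X n \<noteq> x" using X(1) by auto
        then show "norm ((F (X n) \<omega> - F x \<omega>) /\<^sub>R (X n - x)) \<le> G \<omega>"
          using lip[of "X n" \<omega>] by (simp add: divide_inverse_commute[symmetric] pos_divide_le_eq)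
      qed
      show "(\<lambda>\<omega>. (F (X n) \<omega> - F x \<omega>) /\<^sub>R (X n - x)) \<in> borel_measurable M" for n
        using int by (intro borel_measurable_scaleR borel_measurable_diff borel_measurable_const)
          (auto intro: borel_measurable_integrable)
    qed (rule meas)
    then show "((\<lambda>y. ((\<integral>\<omega>. F y \<omega> \<partial>M) - (\<integral>\<omega>. F x \<omega> \<partial>M)) /\<^sub>R (y - x)) \<circ> X) \<longlonglongrightarrow> (\<integral>\<omega>. F' x \<omega> \<partial>M)"
      using int by (simp add: comp_def)
  qed
qed

lemma (in prob_space) integrable_square_imp_integrable:
  fixes X :: "'a \<Rightarrow> real"
  assumes [measurable]: "X \<in> borel_measurable M" and "integrable M (\<lambda>\<omega>. (X \<omega>)\<^sup>2)"
  shows "integrable M X"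
  by (rule square_integrable_imp_integrable) (use assms in auto)

text \<open>A finite second moment yields two derivatives, because
  \<open>\<bar>X \<omega>\<bar>\<close> and \<open>(X \<omega>)\<^sup>2\<close> dominate the first
  and second \<open>t\<close>-derivatives of \<open>iexp (t * X \<omega>)\<close>.\<close>

lemma (in prob_space) char_distr_derivatives:
  fixes X :: "'a \<Rightarrow> real"
  assumes X [measurable]: "X \<in> borel_measurable M"
    and X2: "integrable M (\<lambda>\<omega>. (X \<omega>)\<^sup>2)"
  shows has_vector_derivative_char_distr:
      "(char (distr M borel X) has_vector_derivative
        (\<integral>\<omega>. \<i> * of_real (X \<omega>) * iexp (t * X \<omega>) \<partial>M)) (at t)" (is ?first)
    and has_vector_derivative2_char_distr:
      "((\<lambda>t. \<integral>\<omega>. \<i> * of_real (X \<omega>) * iexp (t * X \<omega>) \<partial>M) has_vector_derivative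
        (\<integral>\<omega>. - of_real ((X \<omega>)\<^sup>2) * iexp (t * X \<omega>) \<partial>M)) (at t)" (is ?second)
proof -
  have intX: "integrable M X"
    by (rule integrable_square_imp_integrable[OF X X2])
  have char: "char (distr M borel X) = (\<lambda>t. \<integral>\<omega>. iexp (t * X \<omega>) \<partial>M)"
    by (rule ext) (simp add: char_def integral_distr)
  show ?first
    unfolding char
  proof (rule has_vector_derivative_integral_dominated[where G = "\<lambda>\<omega>. \<bar>X \<omega>\<bar>"])
    fix s \<omega>
    show "((\<lambda>s. iexp (s * X \<omega>)) has_vector_derivative \<i> * of_real (X \<omega>) * iexp (s * X \<omega>)) (at s)"
      unfolding of_real_mult
      by (rule has_vector_derivative_real_field[where f = "\<lambda>s. exp (\<i> * (s * of_real (X \<omega>)))"])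
        (auto intro!: derivative_eq_intros)
  qed (auto simp: norm_mult intX intro!: integrable_iexp)
  show ?second
  proof (rule has_vector_derivative_integral_dominated[where G = "\<lambda>\<omega>. (X \<omega>)\<^sup>2"])
    fix s \<omega>
    show "((\<lambda>s. \<i> * of_real (X \<omega>) * iexp (s * X \<omega>)) has_vector_derivative
        - of_real ((X \<omega>)\<^sup>2) * iexp (s * X \<omega>)) (at s)"
      unfolding of_real_mult
      by (rule has_vector_derivative_real_field[where f = "\<lambda>s. \<i> * of_real (X \<omega>) * exp (\<i> * (s * of_real (X \<omega>)))"])
        (auto intro!: derivative_eq_intros simp: power2_eq_square algebra_simps)
    show "integrable M (\<lambda>\<omega>. \<i> * of_real (X \<omega>) * iexp (s * X \<omega>))"
      by (rule Bochner_Integration.integrable_bound[OF integrable_norm[OF intX]])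
        (auto simp: norm_mult)
  qed (auto simp: norm_mult norm_power X2)
qed

lemma has_vector_derivative_quotient:
  fixes f g :: "real \<Rightarrow> complex"
  assumes f: "(f has_vector_derivative f') (at x)" and g: "(g has_vector_derivative g') (at x)" and "g x \<noteq> 0"
  shows "((\<lambda>x. f x / g x) has_vector_derivative (f' * g x - f x * g') / (g x)\<^sup>2) (at x)"
  unfolding has_vector_derivative_def
  using has_derivative_divide'[OF f[unfolded has_vector_derivative_def] g[unfolded has_vector_derivative_def] assms(3)]
  by (rule has_derivative_eq_rhs) (simp add: fun_eq_iff power2_eq_square scaleR_conv_of_real field_simps)

text \<open>Where \<open>\<phi>\<close> does not vanish, the hypothesis says that the second derivative of \<open>log \<phi>\<close> is \<open>c\<close>;
  the exponential form then shows that zeros cannot occur.\<close>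
lemma second_log_derivative_constant:
  fixes \<phi> \<phi>1 \<phi>2 :: "real \<Rightarrow> complex"
  assumes d1: "\<And>x. (\<phi> has_vector_derivative \<phi>1 x) (at x)"
    and d2: "\<And>x. (\<phi>1 has_vector_derivative \<phi>2 x) (at x)"
    and \<phi>0: "\<phi> 0 = 1"
    and ode: "\<And>x. \<phi> x \<noteq> 0 \<Longrightarrow> (\<phi>2 x * \<phi> x - (\<phi>1 x)\<^sup>2) / (\<phi> x)\<^sup>2 = c"
  shows "\<phi> x = exp (\<phi>1 0 * of_real x + c * of_real (x\<^sup>2) / 2)"
proof -
  \<comment> \<open>\<open>h\<close> compares \<phi> with the claimed exponential, and
    \<open>k\<close> is the factor for which the derivative of \<open>h\<close> is \<open>k\<close>
    times an exponential. Both \<open>h = 1\<close> and \<open>k = 0\<close> hold at 0.\<close>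
  define h where "h x = \<phi> x * exp (- (\<phi>1 0 * of_real x + c * of_real (x\<^sup>2) / 2))" for x :: real
  define k where "k x = \<phi>1 x - (\<phi>1 0 + c * of_real x) * \<phi> x" for x :: real
  have e: "((\<lambda>x. exp (- (\<phi>1 0 * of_real x + c * of_real (x\<^sup>2) / 2))) has_vector_derivative
      - (\<phi>1 0 + c * of_real x) * exp (- (\<phi>1 0 * of_real x + c * of_real (x\<^sup>2) / 2))) (at x within T)" for x T
    unfolding of_real_power
    by (rule has_vector_derivative_real_field) (auto intro!: derivative_eq_intros)
  have dh: "(h has_vector_derivative
      k x * exp (- (\<phi>1 0 * of_real x + c * of_real (x\<^sup>2) / 2))) (at x)" for x
    unfolding h_def
    by (rule has_vector_derivative_eq_rhs, rule has_vector_derivative_mult[OF d1 e])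
      (simp add: k_def algebra_simps)
  have dk: "(k has_vector_derivative (\<phi>2 x - (c * \<phi> x + (\<phi>1 0 + c * of_real x) * \<phi>1 x))) (at x)" for x
    unfolding k_def
    by (auto intro!: derivative_eq_intros d1 d2 simp: algebra_simps)
  \<comment> \<open>A clopen argument replaces division by \<phi> on the whole line: on
    \<open>S\<close> the equation \<open>h x = 1\<close> forces \<phi> to be nonzero, so the
    differential equation is available near each point of \<open>S\<close>.\<close>
  define S where "S = {x. h x = 1 \<and> k x = 0}"
  have "closed S"
  proof -
    have "continuous_on UNIV h" "continuous_on UNIV k"
      using dh dk by (auto intro!: continuous_at_imp_continuous_on has_vector_derivative_continuous)
    then have "closed ({x. h x = 1} \<inter> {x. k x = 0})"
      by (intro closed_Int closed_Collect_eq continuous_on_const) auto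
    then show ?thesis by (simp add: S_def Collect_conj_eq)
  qed
  moreover have "open S"
    unfolding open_contains_ball
  proof
    fix x assume x: "x \<in> S"
    then have "\<phi> x \<noteq> 0" by (auto simp: S_def h_def)
    moreover have "isCont \<phi> x"
      using d1 has_vector_derivative_continuous by blast
    ultimately obtain e where e: "e > 0" "\<And>y. y \<in> ball x e \<Longrightarrow> \<phi> y \<noteq> 0"
      using continuous_at_avoid[of x \<phi> 0] by (auto simp: dist_commute)
    \<comment> \<open>The quotient is \<open>\<phi>1 y / \<phi> y - (\<phi>1 0 + c * y)\<close>,
      whose derivative is the second log-derivative of \<phi> minus \<open>c\<close>.\<close>
    have dq: "((\<lambda>y. k y / \<phi> y) has_vector_derivative 0) (at y)" if "y \<in> ball x e" for y
    proof (rule has_vector_derivative_eq_rhs, rule has_vector_derivative_quotient[OF dk d1 e(2)[OF that]])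
      show "((\<phi>2 y - (c * \<phi> y + (\<phi>1 0 + c * of_real y) * \<phi>1 y)) * \<phi> y - k y * \<phi>1 y) / (\<phi> y)\<^sup>2 = 0"
        using ode[OF e(2)[OF that]] e(2)[OF that]
        by (simp add: k_def field_simps power2_eq_square)
    qed
    obtain C where C: "\<And>y. y \<in> ball x e \<Longrightarrow> k y / \<phi> y = C"
      by (rule has_vector_derivative_zero_constant[of "ball x e" "\<lambda>y. k y / \<phi> y"])
        (use dq in \<open>auto intro: has_vector_derivative_at_within\<close>)
    \<comment> \<open>The constant value of the quotient is read off at the centre \<open>x\<close>,
      where \<open>k\<close> vanishes; then \<open>h\<close> has derivative 0 on the ball as
      well.\<close>
    have k0: "k y = 0" if "y \<in> ball x e" for y
      using C[of x] C[OF that] x e that by (auto simp: S_def)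
    obtain C' where C': "\<And>y. y \<in> ball x e \<Longrightarrow> h y = C'"
    proof (rule has_vector_derivative_zero_constant[of "ball x e" h])
      show "(h has_vector_derivative 0) (at y within ball x e)" if "y \<in> ball x e" for y
        using dh[of y] k0[OF that] by (auto intro: has_vector_derivative_at_within)
    qed auto
    have "C' = 1"
      using C'[of x] x e(1) by (simp add: S_def)
    then have "ball x e \<subseteq> S"
      using C' k0 unfolding S_def by blast
    then show "\<exists>e>0. ball x e \<subseteq> S" using e(1) by blast
  qed
  moreover have "0 \<in> S" by (simp add: S_def h_def k_def \<phi>0)
  ultimately have "S = UNIV"
    using clopen[of S] by auto
  then have "h x = 1" by (auto simp: S_def)
  then show ?thesis
    by (simp add: h_def exp_minus field_simps)
qed

text \<open>The product rule in logarithmic form keeps the whole product as a factor, so that it can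
  be cancelled later.\<close>

lemma has_vector_derivative_prod_log:
  fixes f :: "'i \<Rightarrow> real \<Rightarrow> complex"
  assumes "\<And>i. i \<in> I \<Longrightarrow> (f i has_vector_derivative f' i) (at x)" "\<And>i. i \<in> I \<Longrightarrow> f i x \<noteq> 0"
  shows "((\<lambda>x. \<Prod>i\<in>I. f i x) has_vector_derivative (\<Prod>i\<in>I. f i x) * (\<Sum>i\<in>I. f' i / f i x)) (at x)"
  using assms
proof (induction I rule: infinite_finite_induct)
  case (insert i I)
  have "((\<lambda>x. f i x * (\<Prod>i\<in>I. f i x)) has_vector_derivative
     (f i x * ((\<Prod>i\<in>I. f i x) * (\<Sum>i\<in>I. f' i / f i x)) + f' i * (\<Prod>i\<in>I. f i x))) (at x)"
    using insert by (intro has_vector_derivative_mult) auto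
  moreover have "f i x \<noteq> 0" using insert by auto
  moreover have "f i x * ((\<Prod>i\<in>I. f i x) * (\<Sum>i\<in>I. f' i / f i x)) + f' i * (\<Prod>i\<in>I. f i x)
      = (f i x * (\<Prod>i\<in>I. f i x)) * (f' i / f i x + (\<Sum>i\<in>I. f' i / f i x))"
    using \<open>f i x \<noteq> 0\<close> by (simp add: distrib_left)
  ultimately show ?case
    using insert.hyps by simp
qed auto

lemma has_vector_derivative_affine_compose:
  fixes f :: "real \<Rightarrow> complex"
  assumes "(f has_vector_derivative f') (at (x + a * s))"
  shows "((\<lambda>s. f (x + a * s)) has_vector_derivative of_real a * f') (at s)"
proof -
  have "((\<lambda>s. x + a * s) has_vector_derivative a) (at s)"
    by (auto intro!: derivative_eq_intros)
  from vector_diff_chain_at[OF this assms] show ?thesis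
    by (simp add: comp_def scaleR_conv_of_real)
qed

text \<open>With \<open>F s t\<close> the product of the
  \<open>\<phi> i (x i + b i * t + a i * s)\<close>, \<open>rank1\<close> reads
  \<open>F s t * F 0 0 = F s 0 * F 0 t\<close>, so the mixed derivative of log \<open>F\<close>
  vanishes at the origin. The quotients \<open>q\<close> of derivative and function stand in for the
  derivative of the logarithm, so no branch has to be chosen.\<close>

lemma rank_one_product_log_derivative:
  fixes \<phi> \<phi>1 \<phi>2 :: "'i \<Rightarrow> real \<Rightarrow> complex" and a b x :: "'i \<Rightarrow> real"
  assumes I: "finite I"
    and d1: "\<And>i y. i \<in> I \<Longrightarrow> (\<phi> i has_vector_derivative \<phi>1 i y) (at y)"
    and d2: "\<And>i y. i \<in> I \<Longrightarrow> (\<phi>1 i has_vector_derivative \<phi>2 i y) (at y)"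
    and nz: "\<And>i. i \<in> I \<Longrightarrow> \<phi> i (x i) \<noteq> 0"
    and rank1: "\<And>s t. (\<Prod>i\<in>I. \<phi> i (x i + b i * t + a i * s)) * (\<Prod>i\<in>I. \<phi> i (x i))
        = (\<Prod>i\<in>I. \<phi> i (x i + a i * s)) * (\<Prod>i\<in>I. \<phi> i (x i + b i * t))"
  shows "(\<Sum>i\<in>I. of_real (a i * b i) *
      ((\<phi>2 i (x i) * \<phi> i (x i) - (\<phi>1 i (x i))\<^sup>2) / (\<phi> i (x i))\<^sup>2)) = 0"
proof -
  define q where "q i y = \<phi>1 i y / \<phi> i y" for i y
  have ds: "((\<lambda>s. \<Prod>i\<in>I. \<phi> i (z i + a i * s)) has_vector_derivative
      (\<Prod>i\<in>I. \<phi> i (z i)) * (\<Sum>i\<in>I. of_real (a i) * q i (z i))) (at 0)"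
    if "\<And>i. i \<in> I \<Longrightarrow> \<phi> i (z i) \<noteq> 0" for z
  proof -
    have "((\<lambda>s. \<phi> i (z i + a i * s)) has_vector_derivative of_real (a i) * \<phi>1 i (z i)) (at 0)" if "i \<in> I" for i
      by (rule has_vector_derivative_affine_compose) (simp add: d1 that)
    then show ?thesis
      using has_vector_derivative_prod_log[where f = "\<lambda>i s. \<phi> i (z i + a i * s)" and x = 0 and I = I
        and f' = "\<lambda>i. of_real (a i) * \<phi>1 i (z i)"] that
      by (simp add: q_def)
  qed
  \<comment> \<open>Differentiating both sides of \<open>rank1\<close> in \<open>s\<close> at 0 and
    cancelling the nonzero products shows that the log-derivative in direction \<open>a\<close> does
    not change with \<open>t\<close>.\<close>
  have const: "(\<Sum>i\<in>I. of_real (a i) * q i (x i + b i * t)) = (\<Sum>i\<in>I. of_real (a i) * q i (x i))"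
    if nzt: "\<And>i. i \<in> I \<Longrightarrow> \<phi> i (x i + b i * t) \<noteq> 0" for t
  proof -
    let ?G = "\<lambda>t. \<Prod>i\<in>I. \<phi> i (x i + b i * t)"
    have "((\<lambda>s. (\<Prod>i\<in>I. \<phi> i (x i + b i * t + a i * s)) * (\<Prod>i\<in>I. \<phi> i (x i))) has_vector_derivative
       ?G t * (\<Sum>i\<in>I. of_real (a i) * q i (x i + b i * t)) * (\<Prod>i\<in>I. \<phi> i (x i))) (at 0)"
      by (intro has_vector_derivative_mult_left ds[OF nzt])
    moreover have "((\<lambda>s. (\<Prod>i\<in>I. \<phi> i (x i + b i * t + a i * s)) * (\<Prod>i\<in>I. \<phi> i (x i))) has_vector_derivative
       (\<Prod>i\<in>I. \<phi> i (x i)) * (\<Sum>i\<in>I. of_real (a i) * q i (x i)) * ?G t) (at 0)"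
      unfolding rank1 by (intro has_vector_derivative_mult_left ds[OF nz])
    ultimately have "?G t * (\<Sum>i\<in>I. of_real (a i) * q i (x i + b i * t)) * (\<Prod>i\<in>I. \<phi> i (x i))
      = (\<Prod>i\<in>I. \<phi> i (x i)) * (\<Sum>i\<in>I. of_real (a i) * q i (x i)) * ?G t"
      by (rule vector_derivative_unique_at)
    moreover have "?G t \<noteq> 0" "(\<Prod>i\<in>I. \<phi> i (x i)) \<noteq> 0"
      using nz nzt I by auto
    ultimately show ?thesis by auto
  qed
  \<comment> \<open>Nonvanishing is assumed at \<open>t = 0\<close> only; continuity spreads it to a
    neighbourhood, which suffices for differentiating at 0.\<close>
  have "\<forall>\<^sub>F t in nhds 0. \<forall>i\<in>I. \<phi> i (x i + b i * t) \<noteq> 0"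
  proof (intro eventually_ball_finite I ballI)
    fix i assume i: "i \<in> I"
    have "isCont (\<phi> i) (x i)"
      using d1[OF i] has_vector_derivative_continuous by blast
    then have "isCont (\<lambda>t. \<phi> i (x i + b i * t)) 0"
      by (intro isCont_o2[where g = "\<phi> i" and f = "\<lambda>t. x i + b i * t"]) auto
    then have "((\<lambda>t. \<phi> i (x i + b i * t)) \<longlongrightarrow> \<phi> i (x i)) (nhds 0)"
      unfolding isCont_def using tendsto_at_iff_tendsto_nhds[of "\<lambda>t. \<phi> i (x i + b i * t)" 0] by simp
    then show "\<forall>\<^sub>F t in nhds 0. \<phi> i (x i + b i * t) \<noteq> 0"
      using nz[OF i] by (rule tendsto_imp_eventually_ne)
  qed
  then have ev: "\<forall>\<^sub>F t in nhds 0. t \<in> UNIV \<longrightarrow> 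
      (\<Sum>i\<in>I. of_real (a i) * q i (x i + b i * t)) = (\<Sum>i\<in>I. of_real (a i) * q i (x i))"
    by eventually_elim (use const in auto)
  \<comment> \<open>The sum is locally constant, so its derivative is 0; computing that derivative
    termwise gives the claimed sum.\<close>
  have "((\<lambda>t. \<Sum>i\<in>I. of_real (a i) * q i (x i + b i * t)) has_vector_derivative 0) (at 0)"
    by (subst has_vector_derivative_cong_ev[OF ev]) auto
  moreover have "((\<lambda>t. \<Sum>i\<in>I. of_real (a i) * q i (x i + b i * t)) has_vector_derivative
    (\<Sum>i\<in>I. of_real (a i) * (of_real (b i) *
      ((\<phi>2 i (x i) * \<phi> i (x i) - (\<phi>1 i (x i))\<^sup>2) / (\<phi> i (x i))\<^sup>2)))) (at 0)"
  proof (intro has_vector_derivative_sum has_vector_derivative_mult_right has_vector_derivative_affine_compose)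
    fix i assume i: "i \<in> I"
    show "(q i has_vector_derivative (\<phi>2 i (x i) * \<phi> i (x i) - (\<phi>1 i (x i))\<^sup>2) / (\<phi> i (x i))\<^sup>2) (at (x i + b i * 0))"
      unfolding q_def using has_vector_derivative_quotient[OF d2[OF i] d1[OF i] nz[OF i]]
      by (simp add: power2_eq_square)
  qed
  ultimately show ?thesis
    by (auto dest: vector_derivative_unique_at simp: mult.assoc)
qed

section \<open>Independent linear forms\<close>

text \<open>Standardising reduces the claim to the standard normal law, where Levy's uniqueness
  theorem applies; the affine change of variables then returns to \<open>X\<close>.\<close>

lemma (in prob_space) gaussian_rv_of_char:
  fixes X :: "'a \<Rightarrow> real"
  assumes X [measurable]: "X \<in> borel_measurable M" and \<sigma>: "\<sigma> > 0"
    and char: "\<And>t. char (distr M borel X) t = exp (\<i> * of_real \<mu> * of_real t - of_real (\<sigma>\<^sup>2 * t\<^sup>2 / 2))"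
  shows "gaussian_rv M X"
proof -
  define Y where "Y \<omega> = (X \<omega> - \<mu>) / \<sigma>" for \<omega>
  have Y [measurable]: "Y \<in> borel_measurable M" unfolding Y_def by measurable
  have "char (distr M borel Y) t = of_real (exp (- (t\<^sup>2) / 2))" for t
  proof -
    have "char (distr M borel Y) t = (\<integral>\<omega>. iexp (t * Y \<omega>) \<partial>M)"
      by (simp add: char_def integral_distr)
    also have "\<dots> = (\<integral>\<omega>. iexp (- (\<mu> * t / \<sigma>)) * iexp (t / \<sigma> * X \<omega>) \<partial>M)"
    proof (intro Bochner_Integration.integral_cong refl)
      fix \<omega>
      have "t * Y \<omega> = - (\<mu> * t / \<sigma>) + t / \<sigma> * X \<omega>"
        using \<sigma> by (simp add: Y_def field_simps)
      then show "iexp (t * Y \<omega>) = iexp (- (\<mu> * t / \<sigma>)) * iexp (t / \<sigma> * X \<omega>)"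
        by (simp only: of_real_add distrib_left exp_add)
    qed
    also have "\<dots> = iexp (- (\<mu> * t / \<sigma>)) * char (distr M borel X) (t / \<sigma>)"
      by (simp add: char_def integral_distr)
    also have "\<dots> = exp (\<i> * of_real (- (\<mu> * t / \<sigma>)) +
        (\<i> * of_real \<mu> * of_real (t / \<sigma>) - of_real (\<sigma>\<^sup>2 * (t / \<sigma>)\<^sup>2 / 2)))"
      by (simp only: char exp_add)
    also have "\<i> * of_real (- (\<mu> * t / \<sigma>)) +
        (\<i> * of_real \<mu> * of_real (t / \<sigma>) - of_real (\<sigma>\<^sup>2 * (t / \<sigma>)\<^sup>2 / 2)) = of_real (- (t\<^sup>2) / 2)"
      using \<sigma> by (simp add: power_divide)
    finally show ?thesis by (simp only: exp_of_real)
  qed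
  then have "char (distr M borel Y) = char std_normal_distribution"
    by (simp add: char_std_normal_distribution fun_eq_iff)
  then have "distr M borel Y = std_normal_distribution"
    using real_distribution_distr[OF Y] real_dist_normal_dist by (intro Levy_uniqueness)
  \<comment> \<open>\<open>distributed\<close> takes the image measure on \<open>lborel\<close>, the
    uniqueness theorem on \<open>borel\<close>; the two have the same measurable sets.\<close>
  moreover have "distr M lborel Y = distr M borel Y"
    by (rule distr_cong) auto
  ultimately have "distributed M lborel Y std_normal_density"
    by (auto simp: distributed_def)
  then have "distributed M lborel X (normal_density \<mu> \<sigma>)"
    unfolding Y_def using normal_standard_normal_convert[OF \<sigma>] by blast
  then show ?thesis
    using \<sigma> unfolding gaussian_rv_def by blast
qed

text \<open>Evaluating at 1 lets \<open>v\<close> carry the argument: the left side is the joint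
  characteristic function of \<open>Z\<close> at \<open>v\<close>.\<close>

lemma (in prob_space) char_linear_combination:
  fixes Z :: "'a \<Rightarrow> real^'d"
  assumes indep: "indep_vars (\<lambda>_. borel) (\<lambda>i \<omega>. Z \<omega> $ i) UNIV"
  shows "char (distr M borel (\<lambda>\<omega>. v \<bullet> Z \<omega>)) 1 = (\<Prod>i\<in>UNIV. char (distr M borel (\<lambda>\<omega>. Z \<omega> $ i)) (v $ i))"
proof -
  have [measurable]: "(\<lambda>\<omega>. Z \<omega> $ i) \<in> borel_measurable M" for i
    using indep by (auto simp: indep_vars_def)
  have "indep_vars (\<lambda>_. borel) (\<lambda>i \<omega>. v $ i * Z \<omega> $ i) UNIV"
    by (rule indep_vars_compose2[OF indep]) auto
  then have "char (distr M borel (\<lambda>\<omega>. \<Sum>i\<in>UNIV. v $ i * Z \<omega> $ i)) 1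
      = (\<Prod>i\<in>UNIV. char (distr M borel (\<lambda>\<omega>. v $ i * Z \<omega> $ i)) 1)"
    by (rule char_distr_sum)
  also have "\<dots> = (\<Prod>i\<in>UNIV. char (distr M borel (\<lambda>\<omega>. Z \<omega> $ i)) (v $ i))"
    by (simp add: char_def integral_distr)
  finally show ?thesis by (simp add: inner_vec_def)
qed

text \<open>As \<open>i \<noteq> k\<close>, each coordinate is moved by at most one of the two
  increments, so for every \<open>m\<close> both sides contain the same two factors, possibly
  swapped.\<close>

lemma prod_rank_one:
  fixes \<chi>' :: "'d::finite \<Rightarrow> real \<Rightarrow> complex" and u :: "real^'d"
  assumes "i \<noteq> k"
  shows "(\<Prod>m\<in>UNIV. \<chi>' m ((u + t *\<^sub>R axis k 1 + s *\<^sub>R axis i 1) $ m)) * (\<Prod>m\<in>UNIV. \<chi>' m (u $ m))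
    = (\<Prod>m\<in>UNIV. \<chi>' m ((u + s *\<^sub>R axis i 1) $ m)) * (\<Prod>m\<in>UNIV. \<chi>' m ((u + t *\<^sub>R axis k 1) $ m))"
  unfolding prod.distrib[symmetric]
  by (rule prod.cong) (use assms in \<open>auto simp: axis_def\<close>)

text \<open>The Darmois--Skitovich theorem for an invertible system of linear forms. Invertibility lets one
  move a single argument of the characteristic functions while the others stay at 0, so the
  Marcinkiewicz theorem is not needed.\<close>
lemma (in prob_space) gaussian_of_independent_linear_forms:
  fixes Z :: "'a \<Rightarrow> real^'d" and B :: "real^'d^'d"
  assumes Z [measurable]: "Z \<in> borel_measurable M"
    and indep: "indep_vars (\<lambda>_. borel) (\<lambda>i \<omega>. Z \<omega> $ i) UNIV"
    and Z2: "\<And>i. integrable M (\<lambda>\<omega>. (Z \<omega> $ i)\<^sup>2)"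
    and B: "invertible B"
    and indepB: "indep_vars (\<lambda>_. borel) (\<lambda>i \<omega>. (B *v Z \<omega>) $ i) UNIV"
    and ik: "i \<noteq> k" and nz: "B $ i $ j \<noteq> 0" "B $ k $ j \<noteq> 0"
    and var: "variance (\<lambda>\<omega>. Z \<omega> $ j) > 0"
  shows "gaussian_rv M (\<lambda>\<omega>. Z \<omega> $ j)"
proof -
  define \<phi> where "\<phi> l = char (distr M borel (\<lambda>\<omega>. Z \<omega> $ l))" for l
  define \<phi>1 where "\<phi>1 l t = (\<integral>\<omega>. \<i> * of_real (Z \<omega> $ l) * iexp (t * Z \<omega> $ l) \<partial>M)" for l t
  define \<phi>2 where "\<phi>2 l t = (\<integral>\<omega>. - of_real ((Z \<omega> $ l)\<^sup>2) * iexp (t * Z \<omega> $ l) \<partial>M)" for l t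
  define L where "L l t = (\<phi>2 l t * \<phi> l t - (\<phi>1 l t)\<^sup>2) / (\<phi> l t)\<^sup>2" for l t
  have Zl [measurable]: "(\<lambda>\<omega>. Z \<omega> $ l) \<in> borel_measurable M" for l
    using indep by (auto simp: indep_vars_def)
  have d1: "(\<phi> l has_vector_derivative \<phi>1 l t) (at t)" for l t
    unfolding \<phi>_def \<phi>1_def by (rule has_vector_derivative_char_distr) (use Z2 in auto)
  have d2: "(\<phi>1 l has_vector_derivative \<phi>2 l t) (at t)" for l t
    unfolding \<phi>1_def \<phi>2_def by (rule has_vector_derivative2_char_distr) (use Z2 in auto)
  have \<phi>0: "\<phi> l 0 = 1" for l
    unfolding \<phi>_def by (intro real_distribution.char_zero real_distribution_distr) auto
  \<comment> \<open>The joint characteristic function of \<open>B *v Z\<close> at \<open>u\<close>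
    is that of \<open>Z\<close> at \<open>transpose B *v u\<close>; both factor by
    independence.\<close>
  have joint: "(\<Prod>l\<in>UNIV. \<phi> l ((transpose B *v u) $ l))
      = (\<Prod>m\<in>UNIV. char (distr M borel (\<lambda>\<omega>. (B *v Z \<omega>) $ m)) (u $ m))" for u
  proof -
    from char_linear_combination[OF indepB, of u] char_linear_combination[OF indep, of "transpose B *v u"]
    show ?thesis
      by (simp add: \<phi>_def dot_lmul_matrix[symmetric] transpose_matrix_vector)
  qed
  have key: "(\<Sum>l\<in>UNIV. of_real (B $ i $ l * B $ k $ l) * L l (x $ l)) = 0"
    if x: "\<And>l. \<phi> l (x $ l) \<noteq> 0" for x :: "real^'d"
  proof -
    \<comment> \<open>Surjectivity of the transpose makes every point \<open>x\<close> reachable;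
      moving \<open>u\<close> along \<open>axis i 1\<close> or \<open>axis k 1\<close> moves
      \<open>x\<close> along row \<open>i\<close> or \<open>k\<close> of \<open>B\<close>.\<close>
    have "invertible (transpose B)" using B by (rule transpose_invertible)
    then have "surj ((*v) (transpose B))"
      unfolding invertible_eq_bij by (rule bij_is_surj)
    then obtain u where u: "x = transpose B *v u" by (metis surjD)
    have lin: "(transpose B *v (u + t *\<^sub>R axis k 1 + s *\<^sub>R axis i 1)) $ l = x $ l + B $ k $ l * t + B $ i $ l * s"
      for s t l
      by (simp add: u matrix_vector_right_distrib matrix_vector_mult_scaleR matrix_vector_mult_basis
          column_def transpose_def mult.commute)
    have lin1: "(transpose B *v (u + t *\<^sub>R axis k 1)) $ l = x $ l + B $ k $ l * t"
      and lin2: "(transpose B *v (u + s *\<^sub>R axis i 1)) $ l = x $ l + B $ i $ l * s" for s t l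
      using lin[of t 0 l] lin[of 0 s l] by simp_all
    show ?thesis
      unfolding L_def
    proof (rule rank_one_product_log_derivative[OF finite d1 d2])
      show "(\<Prod>l\<in>UNIV. \<phi> l (x $ l + B $ k $ l * t + B $ i $ l * s)) * (\<Prod>l\<in>UNIV. \<phi> l (x $ l))
        = (\<Prod>l\<in>UNIV. \<phi> l (x $ l + B $ i $ l * s)) * (\<Prod>l\<in>UNIV. \<phi> l (x $ l + B $ k $ l * t))" for s t
        using prod_rank_one[OF ik, of "\<lambda>m. char (distr M borel (\<lambda>\<omega>. (B *v Z \<omega>) $ m))" u t s]
        unfolding joint[symmetric] lin lin1 lin2 unfolding u .
    qed (rule x)
  qed
  \<comment> \<open>Compare \<open>key\<close> at \<open>axis j y\<close> and at 0: all terms with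
    \<open>l \<noteq> j\<close> coincide, and \<open>\<phi> l 0 = 1\<close> secures nonvanishing in
    the other coordinates. The coefficient of the remaining term is nonzero by
    \<open>nz\<close>.\<close>
  have L: "L j y = L j 0" if "\<phi> j y \<noteq> 0" for y
  proof -
    define x :: "real^'d" where "x = axis j y"
    have split: "(\<Sum>l\<in>UNIV. of_real (B $ i $ l * B $ k $ l) * L l (z $ l))
       = of_real (B $ i $ j * B $ k $ j) * L j (z $ j)
         + (\<Sum>l\<in>UNIV - {j}. of_real (B $ i $ l * B $ k $ l) * L l (z $ l))" for z
      by (rule sum.remove) auto
    have eq: "(\<Sum>l\<in>UNIV - {j}. of_real (B $ i $ l * B $ k $ l) * L l (x $ l))
        = (\<Sum>l\<in>UNIV - {j}. of_real (B $ i $ l * B $ k $ l) * L l (0 $ l))"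
      by (rule sum.cong) (auto simp: x_def axis_def)
    have "\<phi> l (x $ l) \<noteq> 0" for l
      using that by (auto simp: x_def axis_def \<phi>0)
    note 1 = key[of x, OF this, unfolded split eq]
    have "\<phi> l (0 $ l) \<noteq> 0" for l :: 'd
      by (simp add: \<phi>0)
    note 2 = key[of 0, OF this, unfolded split]
    have "complex_of_real (B $ i $ j * B $ k $ j) * L j (x $ j)
        = complex_of_real (B $ i $ j * B $ k $ j) * L j (0 $ j)"
      by (rule add_right_imp_eq[OF trans[OF 1 2[symmetric]]])
    then show ?thesis using nz by (simp add: x_def)
  qed
  have Z1: "integrable M (\<lambda>\<omega>. Z \<omega> $ j)"
    by (rule integrable_square_imp_integrable[OF Zl Z2])
  have \<phi>1_0: "\<phi>1 j 0 = \<i> * of_real (expectation (\<lambda>\<omega>. Z \<omega> $ j))"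
    by (simp add: \<phi>1_def)
  have "\<phi>2 j 0 = - of_real (expectation (\<lambda>\<omega>. (Z \<omega> $ j)\<^sup>2))"
    unfolding \<phi>2_def integral_complex_of_real[symmetric] by simp
  \<comment> \<open>The second log-derivative at 0 is minus the variance, so the exponential
    obtained below is a Gaussian characteristic function.\<close>
  then have L0: "L j 0 = - of_real (variance (\<lambda>\<omega>. Z \<omega> $ j))"
    by (simp add: L_def \<phi>0 \<phi>1_0 variance_eq[OF Z1 Z2] power_mult_distrib)
  have exp: "\<phi> j t = exp (\<phi>1 j 0 * of_real t + L j 0 * of_real (t\<^sup>2) / 2)" for t
    by (rule second_log_derivative_constant[OF d1 d2 \<phi>0]) (use L in \<open>simp add: L_def\<close>)
  show ?thesis
  proof (rule gaussian_rv_of_char[OF Zl, where \<sigma> = "sqrt (variance (\<lambda>\<omega>. Z \<omega> $ j))"])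
    show "char (distr M borel (\<lambda>\<omega>. Z \<omega> $ j)) t = exp (\<i> * of_real (expectation (\<lambda>\<omega>. Z \<omega> $ j)) * of_real t
        - of_real ((sqrt (variance (\<lambda>\<omega>. Z \<omega> $ j)))\<^sup>2 * t\<^sup>2 / 2))" for t
      using exp[of t] var by (simp add: \<phi>_def \<phi>1_0 L0)
  qed (use var in simp)
qed

text \<open>No row of an invertible matrix vanishes, so a nonzero entry can be chosen in each row.
  Two rows cannot choose the same column by \<open>col\<close>, hence the choice \<open>p\<close> is
  injective and, on a finite index set, a permutation.\<close>

lemma monomial_matrix_decomposition:
  fixes B :: "real^'d^'d"
  assumes B: "invertible B" and col: "\<And>i k j. i \<noteq> k \<Longrightarrow> B $ i $ j = 0 \<or> B $ k $ j = 0"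
  shows "\<exists>P \<Lambda>. permutation_matrix P \<and> diagonal_matrix \<Lambda> \<and> invertible \<Lambda> \<and> B = P ** \<Lambda>"
proof -
  have "\<exists>j. B $ i $ j \<noteq> 0" for i
  proof (rule ccontr)
    assume "\<not> ?thesis"
    then have "row i B = 0" by (simp add: row_def vec_eq_iff)
    then have "det B = 0" by (rule det_zero_row)
    then show False using B by (simp add: invertible_det_nz)
  qed
  then obtain p where p: "\<And>i. B $ i $ p i \<noteq> 0" by metis
  have "inj p" using p col by (metis injI)
  then have bij: "bij p" by (simp add: finite_UNIV_inj_surj bij_def)
  \<comment> \<open>Such a column \<open>j\<close> is chosen by some other row, and
    \<open>col\<close> allows it no second nonzero entry.\<close>
  have zero: "B $ i $ j = 0" if "j \<noteq> p i" for i j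
    using that bij p col by (metis bij_pointE)
  \<comment> \<open>The only nonzero entry of column \<open>j\<close> lies in row
    \<open>inv p j\<close>.\<close>
  define \<Lambda> :: "real^'d^'d" where "\<Lambda> = (\<chi> i j. if i = j then B $ inv p j $ j else 0)"
  define P :: "real^'d^'d" where "P = (\<chi> i j. if j = p i then 1 else 0)"
  have diag: "diagonal_matrix \<Lambda>" by (simp add: diagonal_matrix_def \<Lambda>_def)
  have BP: "B = P ** \<Lambda>"
  proof -
    have "(P ** \<Lambda>) $ i $ j = B $ i $ j" for i j
    proof -
      have "(P ** \<Lambda>) $ i $ j = \<Lambda> $ p i $ j"
        by (simp add: matrix_matrix_mult_def P_def if_distrib[of "\<lambda>z. z * _"] cong: if_cong)
      also have "\<dots> = B $ i $ j"
        using zero[of j i] bij by (auto simp: \<Lambda>_def bij_is_inj)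
      finally show ?thesis .
    qed
    then show ?thesis by (simp add: vec_eq_iff)
  qed
  have "invertible \<Lambda>"
    using B by (simp add: BP invertible_det_nz det_mul)
  moreover have "permutation_matrix P"
    unfolding permutation_matrix_def P_def using bij bij_imp_permutes by blast
  ultimately show ?thesis using diag BP by blast
qed

section \<open>Total correlation\<close>

lemma borel_measurable_matrix_vector_mult:
  fixes A :: "real^'n^'m"
  assumes "W \<in> borel_measurable M"
  shows "(\<lambda>\<omega>. A *v W \<omega>) \<in> borel_measurable M"
  by (intro borel_measurable_continuous_on[OF _ assms] linear_continuous_on matrix_vector_mul_bounded_linear)

lemma borel_measurable_vec_component:
  fixes W :: "'a \<Rightarrow> real^'d"
  assumes "W \<in> borel_measurable M"
  shows "(\<lambda>\<omega>. W \<omega> $ i) \<in> borel_measurable M"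
  by (rule measurable_compose[OF assms]) auto

section \<open>Relative entropy vanishes exactly for equal laws\<close>

lemma KL_div_self:
  assumes "prob_space P"
  shows "KL_div P P = 0"
proof -
  interpret P: prob_space P by fact
  have "AE x in P. 1 = RN_deriv P P x"
    by (rule P.RN_deriv_unique) (auto simp: density_1)
  then have ae: "AE x in P. ln (enn2real (RN_deriv P P x)) = 0"
    by eventually_elim (metis enn2real_1 ln_one)
  have "integrable P (\<lambda>x. ln (enn2real (RN_deriv P P x)))"
    using integrable_cong_AE[OF _ _ ae] by simp
  moreover have "(\<integral>x. ln (enn2real (RN_deriv P P x)) \<partial>P) = 0"
    using integral_cong_AE[OF _ _ ae] by simp
  ultimately show ?thesis
    by (simp add: KL_div_def absolutely_continuous_def)
qed

text \<open>This is the equality case of Gibbs' inequality. Base \<open>exp 1\<close> makes the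
  logarithm of the information space the natural one, so \<open>KL_divergence\<close> agrees with
  the integral in \<open>KL_div\<close>.\<close>

lemma KL_div_eq_0_imp_eq:
  assumes P: "prob_space P" and Q: "prob_space Q" and 0: "KL_div P Q = 0"
  shows "P = Q"
proof -
  interpret P: prob_space P by fact
  interpret Q: prob_space Q by fact
  interpret Q: information_space Q "exp 1"
    by unfold_locales simp
  \<comment> \<open>\<open>ennreal\<close> maps every nonpositive real to 0, so vanishing of
    \<open>KL_div\<close> gives only \<open>\<le> 0\<close> for the integral; Gibbs' inequality
    supplies the other direction.\<close>
  have *: "sets P = sets Q" "absolutely_continuous Q P"
    "integrable P (\<lambda>x. ln (enn2real (RN_deriv Q P x)))"
    "(\<integral>x. ln (enn2real (RN_deriv Q P x)) \<partial>P) \<le> 0"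
    using 0 by (auto simp: KL_div_def ennreal_eq_0_iff split: if_splits)
  have ed: "entropy_density (exp 1) Q P = (\<lambda>x. ln (enn2real (RN_deriv Q P x)))"
    by (auto simp: entropy_density_def log_def)
  obtain D where D: "D \<in> borel_measurable Q" "AE x in Q. RN_deriv Q P x = ennreal (D x)"
    "AE x in P. 0 < D x" "\<And>x. 0 \<le> D x"
    using Q.real_RN_deriv[OF _ *(2) *(1)] P.finite_measure_axioms by blast
  have dens: "density Q D = P"
  proof -
    have "density Q D = density Q (RN_deriv Q P)"
      using D by (intro density_cong) auto
    also have "\<dots> = P" using *(1,2) by (intro Q.density_RN_deriv) auto
    finally show ?thesis .
  qed
  \<comment> \<open>Integrability of the log-density under \<open>P\<close> becomes integrability of
    \<open>D\<close> times its logarithm under \<open>Q\<close>, as Gibbs' inequality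
    requires.\<close>
  have "integrable Q (\<lambda>x. D x * log (exp 1) (D x))"
  proof -
    have "AE x in density Q D. ln (enn2real (RN_deriv Q P x)) = ln (D x)"
      using D(1,2,4) by (subst AE_density) (auto elim!: eventually_mono)
    then have "integrable (density Q D) (\<lambda>x. ln (D x))"
      using *(3) D(1) unfolding dens by (subst integrable_cong_AE[symmetric]) (auto simp: measurable_cong_sets[OF *(1) refl])
    then show ?thesis using D by (subst (asm) integrable_density) (auto simp: log_def)
  qed
  then have "0 \<le> KL_divergence (exp 1) Q (density Q D)"
    using D by (intro Q.KL_nonneg) (auto simp: dens P)
  then have "KL_divergence (exp 1) Q P = 0"
    using *(4) by (simp add: dens KL_divergence_def ed)
  then show ?thesis
    using Q.KL_eq_0_iff_eq_ac[OF P *(2) *(1)] *(3) by (simp add: ed)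
qed

section \<open>Independence of components as a product law on vectors\<close>

lemma measurable_vec_nth_PiM [measurable]:
  "(\<lambda>v. \<lambda>i\<in>UNIV. v $ i) \<in> measurable borel (Pi\<^sub>M (UNIV :: 'd::finite set) (\<lambda>i. borel :: real measure))"
  by (intro measurable_restrict) auto

lemma measurable_vec_lambda_PiM [measurable]:
  "(\<lambda>f. \<chi> i. f i) \<in> measurable (Pi\<^sub>M (UNIV :: 'd::finite set) (\<lambda>i. borel :: real measure)) borel"
proof (rule borel_measurable_euclidean_space[THEN iffD2], intro ballI)
  fix b :: "real^'d" assume "b \<in> Basis"
  then obtain i where "b = axis i 1" by (auto simp: Basis_vec_def)
  then show "(\<lambda>f. (\<chi> i. f i) \<bullet> b) \<in> borel_measurable (Pi\<^sub>M UNIV (\<lambda>i. borel))"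
    by (simp add: inner_axis)
qed

text \<open>The known criterion compares laws on the function space \<open>Pi\<^sub>M\<close>,
  whereas \<open>marginal_product\<close> lives on vectors. Measurable, mutually inverse maps carry
  the equality of laws both ways.\<close>

lemma (in prob_space) indep_vars_iff_distr_eq_marginal_product:
  fixes W :: "'a \<Rightarrow> real^'d"
  assumes W [measurable]: "W \<in> borel_measurable M"
  shows "indep_vars (\<lambda>_. borel) (\<lambda>i \<omega>. W \<omega> $ i) UNIV \<longleftrightarrow> distr M borel W = marginal_product M W"
proof -
  let ?P = "Pi\<^sub>M UNIV (\<lambda>i. distr M borel (\<lambda>\<omega>. W \<omega> $ i))"
  note [measurable] = borel_measurable_vec_component[OF W]
  have sets_P: "sets ?P = sets (Pi\<^sub>M UNIV (\<lambda>i. borel))"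
    by (rule sets_PiM_cong) auto
  have iff: "indep_vars (\<lambda>_. borel) (\<lambda>i \<omega>. W \<omega> $ i) UNIV \<longleftrightarrow>
      distr M (Pi\<^sub>M UNIV (\<lambda>i. borel)) (\<lambda>\<omega>. \<lambda>i\<in>UNIV. W \<omega> $ i) = ?P"
    by (rule indep_vars_iff_distr_eq_PiM) auto
  have mW: "(\<lambda>\<omega>. \<lambda>i\<in>UNIV. W \<omega> $ i) \<in> measurable M (Pi\<^sub>M UNIV (\<lambda>i. borel))"
    by measurable
  have fwd: "distr (distr M (Pi\<^sub>M UNIV (\<lambda>i. borel)) (\<lambda>\<omega>. \<lambda>i\<in>UNIV. W \<omega> $ i)) borel (\<lambda>f. \<chi> i. f i) = distr M borel W"
    using distr_distr[OF measurable_vec_lambda_PiM mW] by (simp add: comp_def restrict_UNIV)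
  have bwd: "distr (distr M borel W) (Pi\<^sub>M UNIV (\<lambda>i. borel)) (\<lambda>v. \<lambda>i\<in>UNIV. v $ i)
      = distr M (Pi\<^sub>M UNIV (\<lambda>i. borel)) (\<lambda>\<omega>. \<lambda>i\<in>UNIV. W \<omega> $ i)"
    by (subst distr_distr) (auto simp: comp_def)
  have meas_P: "(\<lambda>f. \<chi> i. f i) \<in> measurable ?P borel"
    using measurable_vec_lambda_PiM measurable_cong_sets[OF sets_P refl] by blast
  have bwd_P: "distr (marginal_product M W) (Pi\<^sub>M UNIV (\<lambda>i. borel)) (\<lambda>v. \<lambda>i\<in>UNIV. v $ i) = ?P"
  proof -
    have "distr (marginal_product M W) (Pi\<^sub>M UNIV (\<lambda>i. borel)) (\<lambda>v. \<lambda>i\<in>UNIV. v $ i)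
      = distr ?P (Pi\<^sub>M UNIV (\<lambda>i. borel)) (\<lambda>f. f)"
      unfolding marginal_product_def 
      using distr_distr[OF measurable_vec_nth_PiM meas_P]
      by (simp add: comp_def restrict_UNIV vec_lambda_inverse)
    also have "\<dots> = ?P" by (rule distr_id2) (simp add: sets_P)
    finally show ?thesis .
  qed
  show ?thesis
    unfolding iff using fwd bwd bwd_P by (metis marginal_product_def)
qed

lemma (in prob_space) prob_space_marginal_product:
  fixes W :: "'a \<Rightarrow> real^'d"
  assumes W [measurable]: "W \<in> borel_measurable M"
  shows "prob_space (marginal_product M W)"
  unfolding marginal_product_def
proof (rule prob_space.prob_space_distr)
  show "prob_space (Pi\<^sub>M UNIV (\<lambda>i. distr M borel (\<lambda>\<omega>. W \<omega> $ i)))"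
    by (intro prob_space_PiM prob_space_distr borel_measurable_vec_component W)
  have "sets (Pi\<^sub>M UNIV (\<lambda>i. distr M borel (\<lambda>\<omega>. W \<omega> $ i))) = sets (Pi\<^sub>M UNIV (\<lambda>i. borel))"
    by (rule sets_PiM_cong) auto
  then show "(\<lambda>f. \<chi> i. f i) \<in> measurable (Pi\<^sub>M UNIV (\<lambda>i. distr M borel (\<lambda>\<omega>. W \<omega> $ i))) borel"
    using measurable_vec_lambda_PiM measurable_cong_sets by blast
qed

lemma (in prob_space) total_correlation_eq_0_iff:
  fixes W :: "'a \<Rightarrow> real^'d"
  assumes W: "W \<in> borel_measurable M"
  shows "total_correlation M W = 0 \<longleftrightarrow> indep_vars (\<lambda>_. borel) (\<lambda>i \<omega>. W \<omega> $ i) UNIV"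
  unfolding indep_vars_iff_distr_eq_marginal_product[OF W] total_correlation_def
  using KL_div_eq_0_imp_eq[OF prob_space_distr[OF W] prob_space_marginal_product[OF W]]
    KL_div_self[OF prob_space_marginal_product[OF W]] by auto

section \<open>Risk minimisers\<close>

lemma integrable_mult_of_squares:
  fixes f h :: "'a \<Rightarrow> real"
  assumes [measurable]: "f \<in> borel_measurable M" "h \<in> borel_measurable M"
    and f: "integrable M (\<lambda>x. (f x)\<^sup>2)" and h: "integrable M (\<lambda>x. (h x)\<^sup>2)"
  shows "integrable M (\<lambda>x. f x * h x)"
proof (rule Bochner_Integration.integrable_bound)
  show "integrable M (\<lambda>x. (f x)\<^sup>2 + (h x)\<^sup>2)" using f h by simp
  have "\<bar>f x * h x\<bar> \<le> (f x)\<^sup>2 + (h x)\<^sup>2" for x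
  proof -
    have "0 \<le> (\<bar>f x\<bar> - \<bar>h x\<bar>)\<^sup>2" by simp
    then have "2 * \<bar>f x * h x\<bar> \<le> (f x)\<^sup>2 + (h x)\<^sup>2"
      by (simp add: power2_diff abs_mult)
    then show ?thesis by simp
  qed
  then show "AE x in M. norm (f x * h x) \<le> norm ((f x)\<^sup>2 + (h x)\<^sup>2)"
    by auto
qed measurable

lemma integrable_square_diff:
  fixes f h :: "'a \<Rightarrow> real"
  assumes "f \<in> borel_measurable M" "h \<in> borel_measurable M"
    and "integrable M (\<lambda>x. (f x)\<^sup>2)" and "integrable M (\<lambda>x. (h x)\<^sup>2)"
  shows "integrable M (\<lambda>x. (f x - h x)\<^sup>2)"
proof -
  have "(\<lambda>x. (f x - h x)\<^sup>2) = (\<lambda>x. (f x)\<^sup>2 + (h x)\<^sup>2 - 2 * (f x * h x))"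
    by (simp add: power2_diff algebra_simps)
  then show ?thesis
    using assms integrable_mult_of_squares[OF assms] by simp
qed

lemma integrable_square_matrix_vector_mult:
  fixes W :: "'a \<Rightarrow> real^'n" and A :: "real^'n^'m"
  assumes W: "W \<in> borel_measurable M" and W2: "\<And>i. integrable M (\<lambda>\<omega>. (W \<omega> $ i)\<^sup>2)"
  shows "integrable M (\<lambda>\<omega>. ((A *v W \<omega>) $ i)\<^sup>2)"
proof -
  have "((A *v W \<omega>) $ i)\<^sup>2 = (\<Sum>j\<in>UNIV. \<Sum>k\<in>UNIV. (A $ i $ j * A $ i $ k) * (W \<omega> $ j * W \<omega> $ k))" for \<omega>
    by (simp add: matrix_vector_mult_def power2_eq_square sum_product ac_simps)
  then show ?thesis
    by (auto intro!: Bochner_Integration.integrable_sum integrable_mult_right integrable_mult_of_squares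
        borel_measurable_vec_component W W2)
qed

text \<open>With \<open>d\<close> the gap between the true and the learned regression function, the
  residual is \<open>N + d (Z)\<close>. Its cross term has expectation 0 because \<open>N\<close> is
  centred and independent of \<open>Z\<close>, so the excess risk is the sum of the second moments
  of the \<open>d i (Z \<omega>)\<close>.\<close>

lemma (in prob_space) regression_risk_minimizer:
  fixes Z Y :: "'a \<Rightarrow> real^'d" and h :: "real^'d \<Rightarrow> real^'d"
  assumes Z [measurable]: "Z \<in> borel_measurable M"
    and Z2: "\<And>i. integrable M (\<lambda>\<omega>. (Z \<omega> $ i)\<^sup>2)"
    and data: "regression_data M Z Y \<Gamma>"
    and h: "h \<in> borel_measurable borel"
    and h2: "\<And>i. integrable M (\<lambda>\<omega>. (h (Z \<omega>) $ i)\<^sup>2)"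
    and le: "(\<integral>\<^sup>+ \<omega>. square_loss (Y \<omega>) (h (Z \<omega>)) \<partial>M) \<le> (\<integral>\<^sup>+ \<omega>. square_loss (Y \<omega>) (\<Gamma> *v Z \<omega>) \<partial>M)"
  shows "AE \<omega> in M. h (Z \<omega>) = \<Gamma> *v Z \<omega>"
proof -
  obtain N where N: "N \<in> borel_measurable M" and indep: "indep_var borel Z borel N"
    and N1: "\<And>i. integrable M (\<lambda>\<omega>. N \<omega> $ i)" "\<And>i. (\<integral>\<omega>. N \<omega> $ i \<partial>M) = 0"
    and N2: "\<And>i. integrable M (\<lambda>\<omega>. (N \<omega> $ i)\<^sup>2)"
    and Y: "\<And>\<omega>. \<omega> \<in> space M \<Longrightarrow> Y \<omega> = \<Gamma> *v Z \<omega> + N \<omega>"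
    using data unfolding regression_data_def by blast
  define d where "d i z = (\<Gamma> *v z) $ i - h z $ i" for i z
  have d [measurable]: "d i \<in> borel_measurable borel" for i
    unfolding d_def
    by (intro borel_measurable_diff borel_measurable_vec_component borel_measurable_matrix_vector_mult h) auto
  have dZ [measurable]: "(\<lambda>\<omega>. d i (Z \<omega>)) \<in> borel_measurable M" for i
    by measurable
  have d2: "integrable M (\<lambda>\<omega>. (d i (Z \<omega>))\<^sup>2)" for i
    unfolding d_def
    by (intro integrable_square_diff borel_measurable_vec_component borel_measurable_matrix_vector_mult Z
        integrable_square_matrix_vector_mult Z2 h2 measurable_compose[OF Z h])
  have d1: "integrable M (\<lambda>\<omega>. d i (Z \<omega>))" for i
    by (rule integrable_square_imp_integrable[OF dZ d2])
  have indep': "indep_var borel (\<lambda>\<omega>. d i (Z \<omega>)) borel (\<lambda>\<omega>. N \<omega> $ i)" for i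
    using indep_var_compose[OF indep d, of "\<lambda>v. v $ i" borel] by (simp add: comp_def)
  have dN: "integrable M (\<lambda>\<omega>. d i (Z \<omega>) * N \<omega> $ i)" "(\<integral>\<omega>. d i (Z \<omega>) * N \<omega> $ i \<partial>M) = 0" for i
    using indep_var_integrable[OF indep' d1 N1(1)] indep_var_lebesgue_integral[OF indep' d1 N1(1)] N1(2)
    by auto
  have sq_norm: "(norm v)\<^sup>2 = (\<Sum>i\<in>UNIV. (v $ i)\<^sup>2)" for v :: "real^'d"
    unfolding power2_norm_eq_inner inner_vec_def by (simp add: power2_eq_square)
  have "(\<integral>\<^sup>+ \<omega>. square_loss (Y \<omega>) (\<Gamma> *v Z \<omega>) \<partial>M) = (\<integral>\<^sup>+ \<omega>. ennreal (\<Sum>i\<in>UNIV. (N \<omega> $ i)\<^sup>2) \<partial>M)"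
    by (intro nn_integral_cong) (simp add: square_loss_def Y sq_norm)
  also have "\<dots> = ennreal (\<integral>\<omega>. (\<Sum>i\<in>UNIV. (N \<omega> $ i)\<^sup>2) \<partial>M)"
    by (intro nn_integral_eq_integral) (auto intro!: N2 sum_nonneg)
  also have "(\<integral>\<omega>. (\<Sum>i\<in>UNIV. (N \<omega> $ i)\<^sup>2) \<partial>M) = (\<Sum>i\<in>UNIV. \<integral>\<omega>. (N \<omega> $ i)\<^sup>2 \<partial>M)"
    by (simp add: N2)
  finally have rhs: "(\<integral>\<^sup>+ \<omega>. square_loss (Y \<omega>) (\<Gamma> *v Z \<omega>) \<partial>M) = ennreal (\<Sum>i\<in>UNIV. \<integral>\<omega>. (N \<omega> $ i)\<^sup>2 \<partial>M)" .
  let ?e = "\<lambda>i \<omega>. (N \<omega> $ i)\<^sup>2 + 2 * (d i (Z \<omega>) * N \<omega> $ i) + (d i (Z \<omega>))\<^sup>2"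
  have sq: "?e i \<omega> = (N \<omega> $ i + d i (Z \<omega>))\<^sup>2" for i \<omega>
    by (simp add: power2_sum)
  have "(\<integral>\<^sup>+ \<omega>. square_loss (Y \<omega>) (h (Z \<omega>)) \<partial>M) = (\<integral>\<^sup>+ \<omega>. ennreal (\<Sum>i\<in>UNIV. ?e i \<omega>) \<partial>M)"
    unfolding sq
    by (intro nn_integral_cong)
      (simp add: square_loss_def Y sq_norm d_def algebra_simps)
  also have "\<dots> = ennreal (\<integral>\<omega>. (\<Sum>i\<in>UNIV. ?e i \<omega>) \<partial>M)"
  proof (intro nn_integral_eq_integral)
    show "integrable M (\<lambda>\<omega>. \<Sum>i\<in>UNIV. ?e i \<omega>)"
      by (intro Bochner_Integration.integrable_sum Bochner_Integration.integrable_add integrable_mult_right N2 dN d2)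
    show "AE \<omega> in M. 0 \<le> (\<Sum>i\<in>UNIV. ?e i \<omega>)"
      unfolding sq by (simp add: sum_nonneg)
  qed
  also have "(\<integral>\<omega>. (\<Sum>i\<in>UNIV. ?e i \<omega>) \<partial>M)
      = (\<Sum>i\<in>UNIV. \<integral>\<omega>. (N \<omega> $ i)\<^sup>2 \<partial>M) + (\<Sum>i\<in>UNIV. \<integral>\<omega>. (d i (Z \<omega>))\<^sup>2 \<partial>M)"
    by (simp add: N2 dN d2 sum.distrib)
  \<comment> \<open>Both risks are now \<open>ennreal\<close> of real numbers, so the common noise
    term can be cancelled.\<close>
  finally have lhs: "(\<integral>\<^sup>+ \<omega>. square_loss (Y \<omega>) (h (Z \<omega>)) \<partial>M) =
      ennreal ((\<Sum>i\<in>UNIV. \<integral>\<omega>. (N \<omega> $ i)\<^sup>2 \<partial>M) + (\<Sum>i\<in>UNIV. \<integral>\<omega>. (d i (Z \<omega>))\<^sup>2 \<partial>M))" .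
  have "(\<Sum>i\<in>UNIV. \<integral>\<omega>. (d i (Z \<omega>))\<^sup>2 \<partial>M) \<le> 0"
    using le unfolding lhs rhs by (subst (asm) ennreal_le_iff) (auto intro!: sum_nonneg)
  moreover have "(\<Sum>i\<in>UNIV. \<integral>\<omega>. (d i (Z \<omega>))\<^sup>2 \<partial>M) \<ge> 0"
    by (intro sum_nonneg) simp
  ultimately have "(\<integral>\<omega>. (d i (Z \<omega>))\<^sup>2 \<partial>M) = 0" for i
    by (subst (asm) antisym_conv, simp, subst (asm) sum_nonneg_eq_0_iff) auto
  then have "AE \<omega> in M. d i (Z \<omega>) = 0" for i
    using integral_nonneg_eq_0_iff_AE[OF d2[of i]] by simp
  then have "AE \<omega> in M. \<forall>i\<in>UNIV. d i (Z \<omega>) = 0"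
    by (intro AE_finite_allI) auto
  then show ?thesis
    by eventually_elim (simp add: d_def vec_eq_iff)
qed

section \<open>Minimisers of the cross-entropy risk\<close>

definition softplus :: "real \<Rightarrow> real" where
  "softplus s = ln (1 + exp s)"

lemma sigmoid_eq: "sigmoid t = exp t / (1 + exp t)"
  by (simp add: sigmoid_def exp_minus field_simps add_pos_pos)

lemma sigmoid_bounds: "0 < sigmoid t" "sigmoid t < 1"
  by (auto simp: sigmoid_eq divide_less_eq_1 add_pos_pos)

lemma sigmoid_strict_mono: "s < t \<Longrightarrow> sigmoid s < sigmoid t"
  unfolding sigmoid_def by (intro divide_strict_left_mono) (auto simp: add_pos_pos)

lemma borel_measurable_sigmoid [measurable]: "sigmoid \<in> borel_measurable borel"
  unfolding sigmoid_def by measurable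

lemma borel_measurable_softplus [measurable]: "softplus \<in> borel_measurable borel"
  unfolding softplus_def by measurable

text \<open>In this form the loss is affine in the label, so averaging replaces \<open>y\<close> by
  its conditional mean, and its only nonlinear part in the logit is the log-partition function
  \<open>softplus\<close>.\<close>

lemma cross_entropy_eq_softplus:
  "- (y * ln (sigmoid s) + (1 - y) * ln (1 - sigmoid s)) = softplus s - y * s"
proof -
  have p: "1 + exp s > 0" by (simp add: add_pos_pos)
  have 1: "ln (sigmoid s) = s - softplus s"
    using p by (simp add: sigmoid_eq softplus_def ln_div)
  have "1 - sigmoid s = 1 / (1 + exp s)"
    using p by (simp add: sigmoid_eq field_simps)
  then have "ln (1 - sigmoid s) = - softplus s"
    using p by (simp add: softplus_def ln_div)
  then show ?thesis unfolding 1 by (simp add: algebra_simps)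
qed

text \<open>Linear growth makes \<open>softplus\<close> of an integrable logit integrable.\<close>

lemma softplus_bound: "0 \<le> softplus s" "softplus s \<le> ln 2 + \<bar>s\<bar>"
proof -
  show "0 \<le> softplus s" by (simp add: softplus_def)
  have "1 + exp s \<le> 2 * exp \<bar>s\<bar>"
    using exp_le_cancel_iff[of s "\<bar>s\<bar>"] one_le_exp_iff[of "\<bar>s\<bar>"] by linarith
  then have "ln (1 + exp s) \<le> ln (2 * exp \<bar>s\<bar>)"
    by (subst ln_le_cancel_iff) (auto simp: add_pos_pos)
  then show "softplus s \<le> ln 2 + \<bar>s\<bar>" by (simp add: softplus_def ln_mult)
qed

lemma DERIV_softplus: "(softplus has_real_derivative sigmoid x) (at x)"
  unfolding softplus_def[abs_def] sigmoid_eq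
  by (auto intro!: derivative_eq_intros simp: add_pos_pos)

text \<open>Strict convexity: by the mean value theorem the chord slope is \<open>sigmoid z\<close>
  for some \<open>z\<close> strictly between \<open>s\<close> and \<open>t\<close>, and
  \<open>sigmoid\<close> is strictly increasing.\<close>

lemma softplus_strictly_above_tangent:
  assumes "s \<noteq> t"
  shows "softplus t + sigmoid t * (s - t) < softplus s"
proof (cases "s < t")
  case True
  obtain z where z: "s < z" "z < t" "softplus t - softplus s = (t - s) * sigmoid z"
    using MVT2[OF True, of softplus sigmoid] DERIV_softplus by blast
  then have "(t - s) * sigmoid z < (t - s) * sigmoid t"
    using True sigmoid_strict_mono by (intro mult_strict_left_mono) auto
  then show ?thesis using z by (simp add: algebra_simps)
next
  case False
  then have st: "t < s" using assms by simp
  obtain z where z: "t < z" "z < s" "softplus s - softplus t = (s - t) * sigmoid z"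
    using MVT2[OF st, of softplus sigmoid] DERIV_softplus by blast
  then have "(s - t) * sigmoid t < (s - t) * sigmoid z"
    using st sigmoid_strict_mono by (intro mult_strict_left_mono) auto
  then show ?thesis using z by (simp add: algebra_simps)
qed

text \<open>By \<open>cond\<close>, the measures with densities \<open>y\<close> and
  \<open>p (Z \<omega>)\<close> have the same image under \<open>Z\<close>; integrating
  \<open>f\<close> against this image gives both sides, whether or not \<open>f\<close> is
  integrable.\<close>

lemma (in prob_space) integral_mult_conditional_probability:
  fixes y :: "'a \<Rightarrow> real" and Z :: "'a \<Rightarrow> 'b::topological_space" and p f :: "'b \<Rightarrow> real"
  assumes Z [measurable]: "Z \<in> borel_measurable M"
    and y [measurable]: "y \<in> borel_measurable M" and y01: "\<And>\<omega>. \<omega> \<in> space M \<Longrightarrow> y \<omega> \<in> {0, 1}"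
    and p [measurable]: "p \<in> borel_measurable borel" and p01: "\<And>z. 0 \<le> p z" "\<And>z. p z \<le> 1"
    and cond: "\<And>B. B \<in> sets borel \<Longrightarrow> measure M {\<omega>\<in>space M. Z \<omega> \<in> B \<and> y \<omega> = 1}
        = (\<integral>\<omega>. indicator {\<omega>\<in>space M. Z \<omega> \<in> B} \<omega> * p (Z \<omega>) \<partial>M)"
    and f [measurable]: "f \<in> borel_measurable borel"
  shows "(\<integral>\<omega>. y \<omega> * f (Z \<omega>) \<partial>M) = (\<integral>\<omega>. p (Z \<omega>) * f (Z \<omega>) \<partial>M)"
proof -
  have eq: "distr (density M (\<lambda>\<omega>. ennreal (y \<omega>))) borel Z = distr (density M (\<lambda>\<omega>. ennreal (p (Z \<omega>)))) borel Z"
  proof (rule measure_eqI)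
    fix B assume "B \<in> sets (distr (density M (\<lambda>\<omega>. ennreal (y \<omega>))) borel Z)"
    then have B [measurable]: "B \<in> sets borel" by simp
    have "emeasure (distr (density M (\<lambda>\<omega>. ennreal (y \<omega>))) borel Z) B
        = (\<integral>\<^sup>+ \<omega>. ennreal (y \<omega>) * indicator (Z -` B \<inter> space M) \<omega> \<partial>M)"
      by (subst emeasure_distr) (auto simp: emeasure_density)
    also have "\<dots> = (\<integral>\<^sup>+ \<omega>. indicator {\<omega>\<in>space M. Z \<omega> \<in> B \<and> y \<omega> = 1} \<omega> \<partial>M)"
      by (intro nn_integral_cong) (use y01 in \<open>fastforce simp: indicator_def\<close>)
    also have "\<dots> = ennreal (measure M {\<omega>\<in>space M. Z \<omega> \<in> B \<and> y \<omega> = 1})"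
      by (subst nn_integral_indicator) (auto simp: emeasure_eq_measure)
    also have "\<dots> = ennreal (\<integral>\<omega>. indicator {\<omega>\<in>space M. Z \<omega> \<in> B} \<omega> * p (Z \<omega>) \<partial>M)"
      by (simp add: cond)
    also have "\<dots> = (\<integral>\<^sup>+ \<omega>. ennreal (indicator {\<omega>\<in>space M. Z \<omega> \<in> B} \<omega> * p (Z \<omega>)) \<partial>M)"
    proof (rule nn_integral_eq_integral[symmetric])
      show "integrable M (\<lambda>\<omega>. indicator {\<omega>\<in>space M. Z \<omega> \<in> B} \<omega> * p (Z \<omega>))"
        by (rule integrable_const_bound[where B = 1]) (auto simp: indicator_def p01)
    qed (simp add: p01)
    also have "\<dots> = (\<integral>\<^sup>+ \<omega>. ennreal (p (Z \<omega>)) * indicator (Z -` B \<inter> space M) \<omega> \<partial>M)"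
      by (intro nn_integral_cong) (auto simp: indicator_def)
    also have "\<dots> = emeasure (distr (density M (\<lambda>\<omega>. ennreal (p (Z \<omega>)))) borel Z) B"
      by (subst emeasure_distr) (auto simp: emeasure_density)
    finally show "emeasure (distr (density M (\<lambda>\<omega>. ennreal (y \<omega>))) borel Z) B
      = emeasure (distr (density M (\<lambda>\<omega>. ennreal (p (Z \<omega>)))) borel Z) B" .
  qed simp
  have "AE \<omega> in M. 0 \<le> y \<omega>" using y01 by (intro AE_I2) fastforce
  then have "(\<integral>\<omega>. y \<omega> * f (Z \<omega>) \<partial>M) = (\<integral>z. f z \<partial>distr (density M (\<lambda>\<omega>. ennreal (y \<omega>))) borel Z)"
    by (simp add: integral_distr integral_real_density)
  also have "\<dots> = (\<integral>\<omega>. p (Z \<omega>) * f (Z \<omega>) \<partial>M)"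
    unfolding eq by (simp add: integral_distr integral_real_density p01)
  finally show ?thesis .
qed

text \<open>Conditioning on \<open>Z\<close> replaces each label by \<sigma>, the slope of
  \<open>softplus\<close> at the true logit. The excess risk is then the expected gap between
  \<open>softplus\<close> and its tangent there, and a zero gap forces equal logits.\<close>

lemma (in prob_space) classification_risk_minimizer:
  fixes Z Y :: "'a \<Rightarrow> real^'d" and h :: "real^'d \<Rightarrow> real^'d"
  assumes Z [measurable]: "Z \<in> borel_measurable M"
    and Z2: "\<And>i. integrable M (\<lambda>\<omega>. (Z \<omega> $ i)\<^sup>2)"
    and data: "classification_data M Z Y \<Gamma>"
    and h: "h \<in> borel_measurable borel"
    and h2: "\<And>i. integrable M (\<lambda>\<omega>. (h (Z \<omega>) $ i)\<^sup>2)"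
    and le: "(\<integral>\<^sup>+ \<omega>. cross_entropy_loss (Y \<omega>) (h (Z \<omega>)) \<partial>M)
      \<le> (\<integral>\<^sup>+ \<omega>. cross_entropy_loss (Y \<omega>) (\<Gamma> *v Z \<omega>) \<partial>M)"
  shows "AE \<omega> in M. h (Z \<omega>) = \<Gamma> *v Z \<omega>"
proof -
  have Y: "Y \<in> borel_measurable M" and Y01: "\<And>\<omega> i. \<omega> \<in> space M \<Longrightarrow> Y \<omega> $ i \<in> {0, 1}"
    and cond: "\<And>i B. B \<in> sets borel \<Longrightarrow> measure M {\<omega>\<in>space M. Z \<omega> \<in> B \<and> Y \<omega> $ i = 1}
          = (\<integral>\<omega>. indicator {\<omega>\<in>space M. Z \<omega> \<in> B} \<omega> * sigmoid ((\<Gamma> *v Z \<omega>) $ i) \<partial>M)"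
    using data by (auto simp: classification_data_def)
  note Yi [measurable] = borel_measurable_vec_component[OF Y]
  define \<sigma> where "\<sigma> i z = sigmoid ((\<Gamma> *v z) $ i)" for i z
  have \<Gamma>_meas: "(*v) \<Gamma> \<in> borel_measurable borel"
    using borel_measurable_matrix_vector_mult[of "\<lambda>z. z" borel \<Gamma>] by simp
  have \<sigma>_meas [measurable]: "\<sigma> i \<in> borel_measurable borel" for i
    unfolding \<sigma>_def by (intro measurable_compose[OF borel_measurable_vec_component[OF \<Gamma>_meas]]) measurable
  \<comment> \<open>\<open>c f z\<close> is the expected loss of the logits \<open>f z\<close> given
    \<open>Z = z\<close>.\<close>
  define c where "c f z = (\<Sum>i\<in>UNIV. softplus (f z $ i) - \<sigma> i z * f z $ i)" for f :: "real^'d \<Rightarrow> real^'d" and z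
  have risk: "(\<integral>\<^sup>+ \<omega>. cross_entropy_loss (Y \<omega>) (f (Z \<omega>)) \<partial>M) = ennreal (\<integral>\<omega>. c f (Z \<omega>) \<partial>M)"
      "0 \<le> (\<integral>\<omega>. c f (Z \<omega>) \<partial>M)" "integrable M (\<lambda>\<omega>. c f (Z \<omega>))"
    if f: "f \<in> borel_measurable borel" and f2: "\<And>i. integrable M (\<lambda>\<omega>. (f (Z \<omega>) $ i)\<^sup>2)"
    for f :: "real^'d \<Rightarrow> real^'d"
  proof -
    note fi [measurable] = borel_measurable_vec_component[OF f]
    have f1: "integrable M (\<lambda>\<omega>. f (Z \<omega>) $ i)" for i
      by (rule integrable_square_imp_integrable[OF measurable_compose[OF Z fi] f2])
    have sp: "integrable M (\<lambda>\<omega>. softplus (f (Z \<omega>) $ i))" for i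
    proof (rule Bochner_Integration.integrable_bound)
      show "integrable M (\<lambda>\<omega>. ln 2 + \<bar>f (Z \<omega>) $ i\<bar>)" using f1 by simp
      show "AE \<omega> in M. norm (softplus (f (Z \<omega>) $ i)) \<le> norm (ln 2 + \<bar>f (Z \<omega>) $ i\<bar>)"
        using softplus_bound[of "f (Z _) $ i"] by (auto simp: abs_of_nonneg)
    qed measurable
    have yf: "integrable M (\<lambda>\<omega>. Y \<omega> $ i * f (Z \<omega>) $ i)" for i
    proof (rule Bochner_Integration.integrable_bound[OF f1[of i]])
      show "AE \<omega> in M. norm (Y \<omega> $ i * f (Z \<omega>) $ i) \<le> norm (f (Z \<omega>) $ i)"
        using Y01[of _ i] by (intro AE_I2) (fastforce simp: abs_mult)
    qed measurable
    have pf: "integrable M (\<lambda>\<omega>. \<sigma> i (Z \<omega>) * f (Z \<omega>) $ i)" for i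
    proof (rule Bochner_Integration.integrable_bound[OF f1[of i]])
      show "AE \<omega> in M. norm (\<sigma> i (Z \<omega>) * f (Z \<omega>) $ i) \<le> norm (f (Z \<omega>) $ i)"
        using sigmoid_bounds by (auto simp: \<sigma>_def abs_mult less_imp_le intro!: mult_left_le_one_le)
    qed measurable
    have cross: "(\<integral>\<omega>. Y \<omega> $ i * f (Z \<omega>) $ i \<partial>M) = (\<integral>\<omega>. \<sigma> i (Z \<omega>) * f (Z \<omega>) $ i \<partial>M)" for i
      using cond Y01
      by (intro integral_mult_conditional_probability[OF Z Yi _ \<sigma>_meas _ _ _ fi])
        (auto simp: \<sigma>_def less_imp_le sigmoid_bounds)
    \<comment> \<open>For labels 0 and 1 a summand is \<open>softplus s\<close> or
      \<open>softplus s - s\<close>. Nonnegativity lets the nonnegative integral be computed as a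
      Bochner integral.\<close>
    have nn: "0 \<le> (\<Sum>i\<in>UNIV. softplus (f (Z \<omega>) $ i) - Y \<omega> $ i * f (Z \<omega>) $ i)" if "\<omega> \<in> space M" for \<omega>
    proof (rule sum_nonneg)
      fix i
      have "softplus s - s \<ge> 0" for s
        by (simp add: softplus_def ln_ge_iff add_pos_pos)
      then show "0 \<le> softplus (f (Z \<omega>) $ i) - Y \<omega> $ i * f (Z \<omega>) $ i"
        using Y01[OF that, of i] softplus_bound(1) by auto
    qed
    have int: "(\<integral>\<omega>. (\<Sum>i\<in>UNIV. softplus (f (Z \<omega>) $ i) - Y \<omega> $ i * f (Z \<omega>) $ i) \<partial>M)
        = (\<integral>\<omega>. c f (Z \<omega>) \<partial>M)"
      by (simp add: c_def sp yf pf cross)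
    have loss: "(\<integral>\<^sup>+ \<omega>. cross_entropy_loss (Y \<omega>) (f (Z \<omega>)) \<partial>M)
        = (\<integral>\<^sup>+ \<omega>. ennreal (\<Sum>i\<in>UNIV. softplus (f (Z \<omega>) $ i) - Y \<omega> $ i * f (Z \<omega>) $ i) \<partial>M)"
      by (simp only: cross_entropy_loss_def cross_entropy_eq_softplus)
    show "(\<integral>\<^sup>+ \<omega>. cross_entropy_loss (Y \<omega>) (f (Z \<omega>)) \<partial>M) = ennreal (\<integral>\<omega>. c f (Z \<omega>) \<partial>M)"
      unfolding int[symmetric] loss by (rule nn_integral_eq_integral) (auto intro!: sp yf nn)
    show "0 \<le> (\<integral>\<omega>. c f (Z \<omega>) \<partial>M)"
      unfolding int[symmetric] by (rule integral_nonneg_AE) (auto intro!: nn)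
    show "integrable M (\<lambda>\<omega>. c f (Z \<omega>))"
      unfolding c_def by (auto intro!: sp pf)
  qed
  have \<Gamma>2: "integrable M (\<lambda>\<omega>. ((\<Gamma> *v Z \<omega>) $ i)\<^sup>2)" for i
    by (rule integrable_square_matrix_vector_mult[OF Z Z2])
  note rh = risk[OF h h2] and r\<Gamma> = risk[OF \<Gamma>_meas \<Gamma>2]
  \<comment> \<open>The Bregman gap of \<open>softplus\<close> between learned and true logit;
    summed over \<open>i\<close> it is the difference of the two conditional risks.\<close>
  define e where "e i z = softplus (h z $ i) - softplus ((\<Gamma> *v z) $ i) - \<sigma> i z * (h z $ i - (\<Gamma> *v z) $ i)" for i z
  have e: "0 \<le> e i z" "e i z = 0 \<Longrightarrow> h z $ i = (\<Gamma> *v z) $ i" for i z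
    using softplus_strictly_above_tangent[of "h z $ i" "(\<Gamma> *v z) $ i"]
    by (cases "h z $ i = (\<Gamma> *v z) $ i"; simp add: e_def \<sigma>_def)+
  have sum_e: "(\<Sum>i\<in>UNIV. e i z) = c h z - c ((*v) \<Gamma>) z" for z
    unfolding c_def sum_subtractf[symmetric] e_def by (simp add: algebra_simps)
  have "(\<integral>\<omega>. c h (Z \<omega>) \<partial>M) \<le> (\<integral>\<omega>. c ((*v) \<Gamma>) (Z \<omega>) \<partial>M)"
    using le unfolding rh(1) r\<Gamma>(1) by (subst (asm) ennreal_le_iff[OF r\<Gamma>(2)])
  then have "(\<integral>\<omega>. (\<Sum>i\<in>UNIV. e i (Z \<omega>)) \<partial>M) \<le> 0"
    unfolding sum_e by (simp add: Bochner_Integration.integral_diff[OF rh(3) r\<Gamma>(3)])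
  moreover have "integrable M (\<lambda>\<omega>. \<Sum>i\<in>UNIV. e i (Z \<omega>))"
    unfolding sum_e by (rule Bochner_Integration.integrable_diff[OF rh(3) r\<Gamma>(3)])
  moreover have "(\<integral>\<omega>. (\<Sum>i\<in>UNIV. e i (Z \<omega>)) \<partial>M) \<ge> 0"
    by (intro integral_nonneg_AE) (simp add: e sum_nonneg)
  ultimately have "AE \<omega> in M. (\<Sum>i\<in>UNIV. e i (Z \<omega>)) = 0"
    by (subst integral_nonneg_eq_0_iff_AE[symmetric]) (auto simp: e sum_nonneg)
  then show ?thesis
  proof eventually_elim
    case (elim \<omega>)
    then have "\<forall>i. e i (Z \<omega>) = 0"
      using e(1) by (subst (asm) sum_nonneg_eq_0_iff) auto
    then show ?case using e(2) by (simp add: vec_eq_iff)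
  qed
qed

section \<open>Identification\<close>

lemma total_correlation_cong_AE:
  fixes W W' :: "'a \<Rightarrow> real^'d"
  assumes W: "W \<in> borel_measurable M" and W': "W' \<in> borel_measurable M"
    and eq: "AE \<omega> in M. W \<omega> = W' \<omega>"
  shows "total_correlation M W = total_correlation M W'"
proof -
  have "distr M borel (\<lambda>\<omega>. W \<omega> $ i) = distr M borel (\<lambda>\<omega>. W' \<omega> $ i)" for i
    using eq by (intro distr_cong_AE borel_measurable_vec_component W W') auto
  moreover have "distr M borel W = distr M borel W'"
    using eq by (intro distr_cong_AE W W') auto
  ultimately show ?thesis
    by (simp add: total_correlation_def marginal_product_def)
qed

text \<open>If the variance were 0, the centred form \<open>r \<bullet> F\<close> would vanish
  almost surely, and \<open>V r\<close>, the expectation of \<open>F\<close> times this form, would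
  be 0 although \<open>r \<noteq> 0\<close>.\<close>

lemma (in prob_space) variance_pos_of_invertible_covariance:
  fixes F :: "'a \<Rightarrow> real^'d"
  assumes F: "F \<in> borel_measurable M"
    and mean: "\<And>i. expectation (\<lambda>\<omega>. F \<omega> $ i) = 0"
    and F2: "\<And>i. integrable M (\<lambda>\<omega>. (F \<omega> $ i)\<^sup>2)"
    and V: "invertible (\<chi> i j. expectation (\<lambda>\<omega>. F \<omega> $ i * F \<omega> $ j))" (is "invertible ?V")
    and r: "r \<noteq> 0"
  shows "variance (\<lambda>\<omega>. \<Sum>l\<in>UNIV. r $ l * F \<omega> $ l) > 0"
proof -
  note Fi [measurable] = borel_measurable_vec_component[OF F]
  have F1: "integrable M (\<lambda>\<omega>. F \<omega> $ i)" for i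
    by (rule integrable_square_imp_integrable[OF Fi F2])
  have FF: "integrable M (\<lambda>\<omega>. F \<omega> $ i * F \<omega> $ j)" for i j
    by (rule integrable_mult_of_squares[OF Fi Fi F2 F2])
  let ?s = "\<lambda>\<omega>. \<Sum>l\<in>UNIV. r $ l * F \<omega> $ l"
  have s0: "expectation ?s = 0"
    by (simp add: F1 mean)
  \<comment> \<open>Every row of the auxiliary matrix is \<open>r\<close>, so each component of its
    product with \<open>F\<close> is the linear form.\<close>
  have s2: "integrable M (\<lambda>\<omega>. (?s \<omega>)\<^sup>2)"
    using integrable_square_matrix_vector_mult[OF F F2, where A = "\<chi> i. r"]
    by (simp add: matrix_vector_mult_def)
  have "expectation (\<lambda>\<omega>. (?s \<omega>)\<^sup>2) \<noteq> 0"
  proof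
    assume "expectation (\<lambda>\<omega>. (?s \<omega>)\<^sup>2) = 0"
    then have ae: "AE \<omega> in M. ?s \<omega> = 0"
      using integral_nonneg_eq_0_iff_AE[OF s2] by simp
    have "(?V *v r) $ i = 0" for i
    proof -
      have "(?V *v r) $ i = expectation (\<lambda>\<omega>. \<Sum>l\<in>UNIV. F \<omega> $ i * F \<omega> $ l * r $ l)"
        by (simp add: matrix_vector_mult_def FF)
      also have "\<dots> = expectation (\<lambda>\<omega>. F \<omega> $ i * ?s \<omega>)"
        by (simp add: sum_distrib_left ac_simps)
      also have "\<dots> = expectation (\<lambda>\<omega>. 0)"
        using ae by (intro integral_cong_AE) auto
      finally show ?thesis by simp
    qed
    then have "?V *v r = 0" by (simp add: vec_eq_iff)
    then show False
      using V[unfolded invertible_left_inverse matrix_left_invertible_ker] r by blast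
  qed
  moreover have "expectation (\<lambda>\<omega>. (?s \<omega>)\<^sup>2) \<ge> 0" by simp
  ultimately show ?thesis unfolding s0 by (simp add: less_le)
qed

lemma
  fixes A :: "real^'n^'n"
  assumes "invertible A"
  shows matrix_inv_left: "matrix_inv A ** A = mat 1"
    and invertible_matrix_inv: "invertible (matrix_inv A)"
proof -
  have "A ** matrix_inv A = mat 1 \<and> matrix_inv A ** A = mat 1"
    unfolding matrix_inv_def by (rule someI_ex) (use assms in \<open>simp add: invertible_def\<close>)
  then show "matrix_inv A ** A = mat 1" "invertible (matrix_inv A)"
    unfolding invertible_def by blast+
qed

theorem theorem3:
  fixes M :: "'a measure"
    and Z X Y :: "'a \<Rightarrow> real^'d"
    and g :: "real^'d \<Rightarrow> real^'d"
    and \<Gamma> :: "real^'d^'d"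
    and H\<Phi> :: "(real^'d \<Rightarrow> real^'d) set"
    and loss :: "real^'d \<Rightarrow> real^'d \<Rightarrow> ennreal"
    and \<Theta>d :: "real^'d^'d" and \<Phi>d :: "real^'d \<Rightarrow> real^'d"
    and U0 \<Lambda>0 \<Omega>d :: "real^'d^'d"
  assumes prob: "prob_space M"
    and Z_rv: "Z \<in> borel_measurable M"
    and Z_indep: "prob_space.indep_vars M (\<lambda>_. borel) (\<lambda>i \<omega>. Z \<omega> $ i) UNIV"
    and Z_nongauss: "\<forall>i. \<not> gaussian_rv M (\<lambda>\<omega>. Z \<omega> $ i)"
    and Z_moments: "\<forall>i. integrable M (\<lambda>\<omega>. (Z \<omega> $ i)\<^sup>2)"
    and g_bij: "bij g" and g_meas: "g \<in> borel_measurable borel"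
    and X_def: "\<forall>\<omega>\<in>space M. X \<omega> = g (Z \<omega>)"
    and data: "(regression_data M Z Y \<Gamma> \<and> loss = square_loss)
             \<or> (classification_data M Z Y \<Gamma> \<and> loss = cross_entropy_loss)"
    and H\<Phi>_inv: "inv g \<in> H\<Phi>"
    and H\<Phi>_meas: "\<forall>\<Phi>\<in>H\<Phi>. \<Phi> \<in> borel_measurable borel"
    and \<Gamma>_inv: "invertible \<Gamma>"
    \<comment> \<open>ERM phase\<close>
    and ERM: "invertible \<Theta>d" "\<Phi>d \<in> H\<Phi>"
      "\<forall>\<Theta> \<Phi>. invertible \<Theta> \<and> \<Phi> \<in> H\<Phi> \<longrightarrow> risk M loss Y X \<Theta>d \<Phi>d \<le> risk M loss Y X \<Theta> \<Phi>"
    \<comment> \<open>ICA phase: zero mean, finite second moments, invertible covariance V\<close>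
    and rep_mean: "\<forall>i. integrable M (\<lambda>\<omega>. \<Phi>d (X \<omega>) $ i) \<and> (\<integral>\<omega>. \<Phi>d (X \<omega>) $ i \<partial>M) = 0"
    and rep_moments: "\<forall>i. integrable M (\<lambda>\<omega>. (\<Phi>d (X \<omega>) $ i)\<^sup>2)"
    and V_inv: "invertible (\<chi> i j. \<integral>\<omega>. \<Phi>d (X \<omega>) $ i * \<Phi>d (X \<omega>) $ j \<partial>M)"
    and eig: "orthogonal_matrix U0" "diagonal_matrix \<Lambda>0" "\<forall>i. \<Lambda>0 $ i $ i > 0"
      "(\<chi> i j. \<integral>\<omega>. \<Phi>d (X \<omega>) $ i * \<Phi>d (X \<omega>) $ j \<partial>M) = U0 ** (\<Lambda>0 ** \<Lambda>0) ** transpose U0"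
    and ICA: "invertible \<Omega>d"
      "\<forall>\<Omega>::real^'d^'d. invertible \<Omega> \<longrightarrow>
         total_correlation M (\<lambda>\<omega>. \<Omega>d *v ((matrix_inv \<Lambda>0 ** transpose U0) *v \<Phi>d (X \<omega>)))
         \<le> total_correlation M (\<lambda>\<omega>. \<Omega> *v ((matrix_inv \<Lambda>0 ** transpose U0) *v \<Phi>d (X \<omega>)))"
  shows "\<exists>P \<Lambda>. permutation_matrix P \<and> diagonal_matrix \<Lambda> \<and> invertible \<Lambda> \<and>
           (AE \<omega> in M. \<Omega>d *v ((matrix_inv \<Lambda>0 ** transpose U0) *v \<Phi>d (X \<omega>)) = (P ** \<Lambda>) *v Z \<omega>)"
proof -
  interpret prob_space M by (rule prob)
  have Z2: "\<And>i. integrable M (\<lambda>\<omega>. (Z \<omega> $ i)\<^sup>2)" using Z_moments by blast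
  have \<Phi>d: "\<Phi>d \<in> borel_measurable borel" using H\<Phi>_meas ERM(2) by blast
  have \<Phi>dg: "(\<lambda>z. \<Phi>d (g z)) \<in> borel_measurable borel"
    by (rule measurable_compose[OF g_meas \<Phi>d])
  have F: "(\<lambda>\<omega>. \<Phi>d (X \<omega>)) \<in> borel_measurable M"
    using measurable_compose[OF Z_rv \<Phi>dg] X_def by (simp cong: measurable_cong)
  \<comment> \<open>The learned logits as a function of the latent vector, which is how the risk
    lemmas take a predictor.\<close>
  define h where "h z = \<Theta>d *v \<Phi>d (g z)" for z
  have h: "h \<in> borel_measurable borel"
    unfolding h_def by (rule borel_measurable_matrix_vector_mult[OF \<Phi>dg])
  have h2: "integrable M (\<lambda>\<omega>. (h (Z \<omega>) $ i)\<^sup>2)" for i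
  proof -
    have "integrable M (\<lambda>\<omega>. ((\<Theta>d *v \<Phi>d (X \<omega>)) $ i)\<^sup>2)"
      using rep_moments by (intro integrable_square_matrix_vector_mult[OF F]) auto
    then show ?thesis
      using X_def by (simp add: h_def cong: Bochner_Integration.integrable_cong)
  qed
  \<comment> \<open>The competitor is \<Gamma> composed with \<open>inv g\<close>: it is admissible,
    and its logits are exactly \<open>\<Gamma> *v Z \<omega>\<close>.\<close>
  have le: "(\<integral>\<^sup>+ \<omega>. loss (Y \<omega>) (h (Z \<omega>)) \<partial>M) \<le> (\<integral>\<^sup>+ \<omega>. loss (Y \<omega>) (\<Gamma> *v Z \<omega>) \<partial>M)"
  proof -
    have "risk M loss Y X \<Theta>d \<Phi>d = (\<integral>\<^sup>+ \<omega>. loss (Y \<omega>) (h (Z \<omega>)) \<partial>M)"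
      unfolding risk_def h_def using X_def by (intro nn_integral_cong) auto
    moreover have "risk M loss Y X \<Gamma> (inv g) = (\<integral>\<^sup>+ \<omega>. loss (Y \<omega>) (\<Gamma> *v Z \<omega>) \<partial>M)"
      unfolding risk_def using X_def g_bij by (intro nn_integral_cong) (auto simp: bij_is_inj)
    ultimately show ?thesis
      using ERM(3) \<Gamma>_inv H\<Phi>_inv by metis
  qed
  have "AE \<omega> in M. h (Z \<omega>) = \<Gamma> *v Z \<omega>"
    using data
  proof
    assume "regression_data M Z Y \<Gamma> \<and> loss = square_loss"
    then show ?thesis
      using regression_risk_minimizer[OF Z_rv Z2 _ h h2] le by blast
  next
    assume "classification_data M Z Y \<Gamma> \<and> loss = cross_entropy_loss"
    then show ?thesis
      using classification_risk_minimizer[OF Z_rv Z2 _ h h2] le by blast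
  qed
  then have erm: "AE \<omega> in M. \<Theta>d *v \<Phi>d (X \<omega>) = \<Gamma> *v Z \<omega>"
    using AE_space by eventually_elim (use X_def in \<open>simp add: h_def\<close>)

  \<comment> \<open>\<open>A\<close> is the residual mixing matrix: after the ERM phase the
    representation is \<open>A *v Z \<omega>\<close> almost surely.\<close>
  define A where "A = matrix_inv \<Theta>d ** \<Gamma>"
  have A: "invertible A"
    unfolding A_def by (intro invertible_mult invertible_matrix_inv ERM(1) \<Gamma>_inv)
  have rep: "AE \<omega> in M. \<Phi>d (X \<omega>) = A *v Z \<omega>"
    using erm
  proof eventually_elim
    case (elim \<omega>)
    then have "matrix_inv \<Theta>d *v (\<Theta>d *v \<Phi>d (X \<omega>)) = matrix_inv \<Theta>d *v (\<Gamma> *v Z \<omega>)" by simp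
    then show ?case
      by (simp add: A_def matrix_vector_mul_assoc matrix_inv_left[OF ERM(1)])
  qed

  \<comment> \<open>\<open>gaussian_rv\<close> demands a positive standard deviation, so
    \<open>Z_nongauss\<close> leaves room for constant components. These are excluded by the
    invertible covariance, since \<open>Z \<omega> $ j\<close> is row \<open>j\<close> of the
    inverse of \<open>A\<close> applied to the representation.\<close>
  have var: "variance (\<lambda>\<omega>. Z \<omega> $ j) > 0" for j
  proof -
    define R where "R = matrix_inv A"
    have "invertible R" unfolding R_def by (rule invertible_matrix_inv[OF A])
    then have "R $ j \<noteq> 0"
      using det_zero_row[of j R] by (auto simp: invertible_det_nz row_def vec_eq_iff)
    then have pos: "variance (\<lambda>\<omega>. \<Sum>l\<in>UNIV. R $ j $ l * \<Phi>d (X \<omega>) $ l) > 0"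
      using rep_mean rep_moments by (intro variance_pos_of_invertible_covariance[OF F _ _ V_inv]) auto
    have ae: "AE \<omega> in M. (\<Sum>l\<in>UNIV. R $ j $ l * \<Phi>d (X \<omega>) $ l) = Z \<omega> $ j"
      using rep
    proof eventually_elim
      case (elim \<omega>)
      have "(\<Sum>l\<in>UNIV. R $ j $ l * \<Phi>d (X \<omega>) $ l) = (R *v \<Phi>d (X \<omega>)) $ j"
        by (simp add: matrix_vector_mult_def)
      also have "\<dots> = Z \<omega> $ j"
        by (simp add: elim matrix_vector_mul_assoc R_def matrix_inv_left[OF A])
      finally show ?case .
    qed
    note [measurable] = borel_measurable_vec_component[OF F] borel_measurable_vec_component[OF Z_rv]
    have "expectation (\<lambda>\<omega>. \<Sum>l\<in>UNIV. R $ j $ l * \<Phi>d (X \<omega>) $ l) = expectation (\<lambda>\<omega>. Z \<omega> $ j)"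
      by (rule integral_cong_AE[OF _ _ ae]) measurable
    then have "variance (\<lambda>\<omega>. \<Sum>l\<in>UNIV. R $ j $ l * \<Phi>d (X \<omega>) $ l) = variance (\<lambda>\<omega>. Z \<omega> $ j)"
      using ae by (intro integral_cong_AE) (auto elim!: eventually_mono)
    then show ?thesis using pos by simp
  qed

  \<comment> \<open>\<open>C\<close> is the whitening matrix, invertible because \<Lambda>0 has a
    positive diagonal and \<open>U0\<close> is orthogonal. The ICA output is then
    \<open>B *v Z \<omega>\<close> with \<open>B\<close> a product of invertible matrices.\<close>
  define C where "C = matrix_inv \<Lambda>0 ** transpose U0"
  have "det \<Lambda>0 = (\<Prod>i\<in>UNIV. \<Lambda>0 $ i $ i)"
    using eig(2) by (intro det_diagonal) (auto simp: diagonal_matrix_def)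
  then have "invertible \<Lambda>0"
    using eig(3) by (simp add: invertible_det_nz less_imp_neq[symmetric] prod_zero_iff)
  moreover have "invertible (transpose U0)"
    using eig(1) by (auto simp: orthogonal_matrix_def invertible_def)
  ultimately have C: "invertible C"
    unfolding C_def by (intro invertible_mult invertible_matrix_inv)
  define B where "B = \<Omega>d ** C ** A"
  have B: "invertible B"
    unfolding B_def by (intro invertible_mult ICA(1) C A)
  have out: "AE \<omega> in M. \<Omega> *v (C *v \<Phi>d (X \<omega>)) = (\<Omega> ** C ** A) *v Z \<omega>" for \<Omega> :: "real^'d^'d"
    using rep by eventually_elim (simp add: matrix_vector_mul_assoc matrix_mul_assoc)
  have tc: "total_correlation M (\<lambda>\<omega>. \<Omega> *v (C *v \<Phi>d (X \<omega>))) = total_correlation M (\<lambda>\<omega>. (\<Omega> ** C ** A) *v Z \<omega>)"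
    for \<Omega> :: "real^'d^'d"
    by (intro total_correlation_cong_AE out borel_measurable_matrix_vector_mult F Z_rv)
  have BZ: "(\<lambda>\<omega>. B *v Z \<omega>) \<in> borel_measurable M"
    by (rule borel_measurable_matrix_vector_mult[OF Z_rv])
  have "total_correlation M (\<lambda>\<omega>. B *v Z \<omega>) = 0"
  proof -
    \<comment> \<open>This unmixing matrix recovers \<open>Z\<close> itself, whose total correlation
      is 0, so the minimum attained by \<open>\<Omega>d\<close> is 0 as well.\<close>
    let ?\<Omega> = "matrix_inv (C ** A)"
    have CA: "invertible (C ** A)" by (intro invertible_mult C A)
    then have "total_correlation M (\<lambda>\<omega>. \<Omega>d *v (C *v \<Phi>d (X \<omega>))) \<le> total_correlation M (\<lambda>\<omega>. ?\<Omega> *v (C *v \<Phi>d (X \<omega>)))"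
      using ICA(2) invertible_matrix_inv unfolding C_def by blast
    moreover have "?\<Omega> ** C ** A = mat 1"
      using matrix_inv_left[OF CA] by (simp add: matrix_mul_assoc)
    ultimately have "total_correlation M (\<lambda>\<omega>. B *v Z \<omega>) \<le> total_correlation M Z"
      unfolding tc by (simp add: B_def)
    also have "\<dots> = 0"
      using total_correlation_eq_0_iff[OF Z_rv] Z_indep by blast
    finally show ?thesis by simp
  qed
  then have indepB: "indep_vars (\<lambda>_. borel) (\<lambda>i \<omega>. (B *v Z \<omega>) $ i) UNIV"
    using total_correlation_eq_0_iff[OF BZ] by blast
  \<comment> \<open>Two nonzero entries in column \<open>j\<close> would make
    \<open>Z \<omega> $ j\<close> Gaussian.\<close>
  have "B $ i $ j = 0 \<or> B $ k $ j = 0" if "i \<noteq> k" for i k j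
    using gaussian_of_independent_linear_forms[OF Z_rv Z_indep Z2 B indepB that _ _ var] Z_nongauss by blast
  from monomial_matrix_decomposition[OF B this]
  obtain P \<Lambda> where P: "permutation_matrix P" "diagonal_matrix \<Lambda>" "invertible \<Lambda>" "B = P ** \<Lambda>"
    by blast
  then have "AE \<omega> in M. \<Omega>d *v ((matrix_inv \<Lambda>0 ** transpose U0) *v \<Phi>d (X \<omega>)) = (P ** \<Lambda>) *v Z \<omega>"
    using out[of \<Omega>d] unfolding B_def C_def by simp
  then show ?thesis using P by blast
qed

end
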